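(* For every integer $n>0$ there exists an integer $k=k(n)$ such that $\mathrm{xc}(P_{\mathcal{I}_{n,k}})=2^{\Omega(n)}$.
   Context: For $n\ge 1$ let $G_n=(U,V,E)$ be the bipartite multigraph with $|U|=|V|=n$ in which, for every $u\in U$ and $v\in V$, there are exactly two parallel edges between $u$ and $v$, one colored red and one colored blue. For an integer $k$, the instance $\mathcal{I}_{n,k}=(G_n,k)$ has associated polytope $P_{\mathcal{I}_{n,k}}:=\mathrm{conv}(\{\chi^M : M \text{ is a perfect matching of } G_n \text{ with exactly } k \text{ red edges}\})\subseteq\mathbb{R}^E$, where $\chi^M$ is the characteristic vector of $M$. The extension complexity $\mathrm{xc}(P)$ of a polytope $P$ is the smallest integer $r>0$ such that $P$ is a linear projection of some polytope with $r$ facets. *)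

theory Defs
  imports "HOL-Analysis.Analysis" "HOL-Analysis.Finite_Function_Topology" "HOL-Library.Landau_Symbols"
begin

text \<open>
  The extension complexity quantifies over polytopes in spaces of arbitrary finite dimension.  Vectors
  are therefore finitely supported functions, and \<open>\<real>\<^sup>I\<close> is the set of those supported in \<open>I\<close>.
\<close>

definition coord_space :: "'i set \<Rightarrow> ('i \<Rightarrow>\<^sub>0 real) set" where
  "coord_space I = {x. Poly_Mapping.keys x \<subseteq> I}"

text \<open>
  The library defines \<open>aff_dim\<close> and \<open>facet_of\<close> only for Euclidean spaces, so they are repeated here
  for real vector spaces.  The two lemmas show agreement with the library versions.
\<close>

definition affine_dim :: "'a::real_vector set \<Rightarrow> int" where
  "affine_dim S = (SOME d. \<exists>B. finite B \<and> affine hull B = affine hull S \<and>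
                               \<not> affine_dependent B \<and> int (card B) = d + 1)"

definition is_facet_of :: "'a::real_vector set \<Rightarrow> 'a set \<Rightarrow> bool" where
  "is_facet_of F S \<longleftrightarrow> F face_of S \<and> F \<noteq> {} \<and> affine_dim F = affine_dim S - 1"

lemma affine_dim_eq_aff_dim: "affine_dim S = aff_dim (S :: 'a::euclidean_space set)"
proof -
  have "(finite B \<and> affine hull B = affine hull S \<and> \<not> affine_dependent B \<and> int (card B) = d + 1)
      \<longleftrightarrow> (affine hull B = affine hull S \<and> \<not> affine_dependent B \<and> int (card B) = d + 1)"
    for B :: "'a set" and d
    using aff_independent_finite by blast
  then show ?thesis
    unfolding affine_dim_def aff_dim_def by simp
qed

lemma is_facet_of_eq_facet_of: "is_facet_of F S \<longleftrightarrow> F facet_of (S :: 'a::euclidean_space set)"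
  by (simp add: is_facet_of_def facet_of_def affine_dim_eq_aff_dim)

text \<open>
  If \<open>P\<close> is empty or not a polytope, the set below is empty and the value is \<open>Inf {} = 0\<close>.
\<close>

definition extension_complexity :: "('i \<Rightarrow>\<^sub>0 real) set \<Rightarrow> nat" where
  "extension_complexity P =
     Inf {r. r > 0 \<and>
             (\<exists>m (Q :: (nat \<Rightarrow>\<^sub>0 real) set) (\<pi> :: (nat \<Rightarrow>\<^sub>0 real) \<Rightarrow> ('i \<Rightarrow>\<^sub>0 real)).
                Q \<subseteq> coord_space {..<m} \<and> polytope Q \<and> card {F. is_facet_of F Q} = r \<and>
                linear \<pi> \<and> \<pi> ` Q = P)}"

text \<open>
  The edges \<open>(u, v, Red)\<close> and \<open>(u, v, Blue)\<close> are the two parallel edges between \<open>Inl u \<in> U\<close>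
  and \<open>Inr v \<in> V\<close>, where \<open>u, v < n\<close>.
\<close>

datatype color = Red | Blue

type_synonym vertex = "nat + nat"
type_synonym edge = "nat \<times> nat \<times> color"

definition vertices :: "nat \<Rightarrow> vertex set" where
  "vertices n = {..<n} <+> {..<n}"

definition edges :: "nat \<Rightarrow> edge set" where
  "edges n = {..<n} \<times> {..<n} \<times> UNIV"

fun ends :: "edge \<Rightarrow> vertex set" where
  "ends (u, v, c) = {Inl u, Inr v}"

fun edge_color :: "edge \<Rightarrow> color" where
  "edge_color (u, v, c) = c"

definition perfect_matching :: "nat \<Rightarrow> edge set \<Rightarrow> bool" where
  "perfect_matching n M \<longleftrightarrow> M \<subseteq> edges n \<and> (\<forall>w \<in> vertices n. \<exists>!e. e \<in> M \<and> w \<in> ends e)"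

definition char_vec :: "'i set \<Rightarrow> ('i \<Rightarrow>\<^sub>0 real)" where
  "char_vec M = Abs_poly_mapping (indicator M)"

lemma lookup_char_vec: "finite M \<Longrightarrow> Poly_Mapping.lookup (char_vec M) = indicator M"
  unfolding char_vec_def
  by (rule Abs_poly_mapping_inverse) (simp add: indicator_def)

definition exact_matching_polytope :: "nat \<Rightarrow> int \<Rightarrow> (edge \<Rightarrow>\<^sub>0 real) set" where
  "exact_matching_polytope n k =
     convex hull {char_vec M | M.
       perfect_matching n M \<and> int (card {e \<in> M. edge_color e = Red}) = k}"

end

theory Submission
  imports Defs
begin

text \<open>
  Switching the colours of all edges at the vertices of a set \<open>Z\<close> of even size keeps the parity of the
  number of red edges of every perfect matching.  So if this number is odd, some edge is red
  (``violated'') after the switch, and the number of violated edges minus one is a slack matrix entry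
  of the exact matching polytope.  An extension with \<open>r\<close> facets writes the columns with \<open>k\<close> red
  edges as a sum of \<open>r\<close> nonnegative rank-one matrices; letting \<open>k\<close> vary costs a factor \<open>n + 1\<close>.

  The nonnegative rank is bounded below by hyperplane separation, as in Rothvoss' theorem on the
  matching polytope.  Compare the averages of a matrix over random pairs with three and with five
  violated edges.  For the slack matrix their ratio is \<open>2 : 4\<close>.  A rank-one term vanishes on
  all pairs with exactly one violated edge, and for such a term the first average is at most
  \<open>0.49\<close> times the second, up to an exponentially small error.  Indeed, on either side the part that
  distinguishes three from five violations is one of \<open>N\<close> interchangeable two-state gadgets, and by an
  entropy argument the state of a random gadget is almost unbiased, so both states carry almost the
  same weight.  It remains to see which three of five special edges can be the violated ones: if the
  term is positive for two triples whose complements are disjoint, then combining the cut of one with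
  the matching of the other gives exactly one violated edge.  So at most two of the five
  rotations of a triple occur, and \<open>2/5 < 1/2\<close>.
\<close>

subsection \<open>Facets and nonnegative factorizations of slacks\<close>

text \<open>The matching with state set \<open>b\<close> has \<open>3 + 2 * (N - card b)\<close> red
  edges. The entropy argument needs the uniform distribution on all state sets, so no single number
  of red edges contains the whole family. This is why all odd numbers are treated together and why
  \<open>k\<close> comes out as a maximiser rather than as a formula. Pairs with one violated edge
  have slack zero and therefore restrict the supports of the rank-one terms; three and five are the
  next values that parity permits. The value 49/100 only has to lie between the proportion 2/5,
  enlarged by the imbalance tolerated between the two states of a gadget, and the ratio 1/2 of the
  slack matrix. Extensions live in a space of finitely supported functions of unbounded dimension,
  so facets are treated algebraically, as zero sets of affine functions spanning extreme rays of a
  cone over a finite point set.\<close>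

lemma affine_hull_card_unique:
  fixes B C :: "'a::real_vector set"
  assumes B: "finite B" "\<not> affine_dependent B" and C: "finite C" "\<not> affine_dependent C"
    and eq: "affine hull B = affine hull C"
  shows "card B = card C"
proof (cases "B = {}")
  case True
  then show ?thesis using eq by auto
next
  case False
  then obtain b where b: "b \<in> B" by blast
  have "C \<noteq> {}" using eq b by (metis affine_hull_empty empty_iff hull_inc)
  then obtain c where c: "c \<in> C" by blast
  let ?B = "(\<lambda>x. -b + x) ` (B - {b})" and ?C = "(\<lambda>x. -c + x) ` (C - {c})"
  have iB: "independent ?B" and iC: "independent ?C"
    using B C b c affine_dependent_iff_dependent2 by blast+
  have hB: "affine hull B = (\<lambda>x. b + x) ` span ?B" and hC: "affine hull C = (\<lambda>x. c + x) ` span ?C"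
    using affine_hull_span2 b c by blast+
  have "c \<in> (\<lambda>x. b + x) ` span ?B" using hB eq c by (metis hull_inc)
  then have cb: "c - b \<in> span ?B" by auto
  \<comment> \<open>The hulls are translates of these spans by \<open>b\<close> and
    \<open>c\<close>; since \<open>c - b\<close> lies in the first span, the translations
    cancel.\<close>
  have "span ?B = span ?C"
  proof (intro set_eqI iffI)
    fix x assume "x \<in> span ?B"
    then have "c - b + x \<in> span ?B" using cb span_add by blast
    then have "b + (c - b + x) \<in> affine hull C" using hB eq by blast
    then show "x \<in> span ?C" using hC by auto
  next
    fix x assume "x \<in> span ?C"
    then have "c + x \<in> affine hull B" using hC eq by blast
    then obtain y where "y \<in> span ?B" "c + x = b + y" using hB by auto
    then have "x = y - (c - b)" by (simp add: algebra_simps)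
    then show "x \<in> span ?B" using cb span_diff \<open>y \<in> span ?B\<close> by blast
  qed
  then have "card ?B = card ?C"
    using iB iC by (metis dim_eq_card)
  moreover have "card ?B = card B - 1" "card ?C = card C - 1"
    using b c B(1) C(1) by (simp_all add: card_image)
  moreover have "card B > 0" "card C > 0" using b c B(1) C(1) by (auto simp: card_gt_0_iff)
  ultimately show ?thesis by linarith
qed

text \<open>The choice in \<open>affine_dim\<close> ranges over all affine bases of the hull. They
  all have the same size, so exhibiting one of them determines the value.\<close>

lemma affine_dim_eqI:
  assumes "finite B" "\<not> affine_dependent B" "affine hull B = affine hull S"
  shows "affine_dim S = int (card B) - 1"
  unfolding affine_dim_def
proof (rule some_equality)
  show "\<exists>C. finite C \<and> affine hull C = affine hull S \<and> \<not> affine_dependent C \<and>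
            int (card C) = int (card B) - 1 + 1"
    using assms by auto
next
  fix d
  assume "\<exists>C. finite C \<and> affine hull C = affine hull S \<and> \<not> affine_dependent C \<and> int (card C) = d + 1"
  then obtain C where "finite C" "affine hull C = affine hull S" "\<not> affine_dependent C" "int (card C) = d + 1"
    by blast
  then show "d = int (card B) - 1"
    using affine_hull_card_unique[of B C] assms by simp
qed

section \<open>Affine functions and algebraic separation\<close>

definition affine_fun :: "('a::real_vector \<Rightarrow> real) \<Rightarrow> bool" where
  "affine_fun f \<longleftrightarrow> (\<exists>l c. linear l \<and> f = (\<lambda>x. l x + c))"

lemma affine_funE:
  assumes "affine_fun f"
  obtains l c where "linear l" "f = (\<lambda>x. l x + c)"
  using assms affine_fun_def by blast

lemma affine_fun_const: "affine_fun (\<lambda>x. c)"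
  unfolding affine_fun_def by (rule exI[of _ "\<lambda>x. 0"]) (auto intro: linear_zero)

lemma affine_fun_combine:
  assumes "affine_fun f" "affine_fun g"
  shows "affine_fun (\<lambda>x. a * f x + b * g x)"
proof -
  obtain l c where 1: "linear l" "f = (\<lambda>x. l x + c)" using assms(1) by (rule affine_funE)
  obtain k d where 2: "linear k" "g = (\<lambda>x. k x + d)" using assms(2) by (rule affine_funE)
  have "linear (\<lambda>x. a *\<^sub>R l x + b *\<^sub>R k x)"
    using 1 2 by (intro linear_compose_add linear_compose_scale_right)
  moreover have "(\<lambda>x. a * f x + b * g x) = (\<lambda>x. (a *\<^sub>R l x + b *\<^sub>R k x) + (a * c + b * d))"
    unfolding 1 2 by (simp add: algebra_simps)
  ultimately show ?thesis unfolding affine_fun_def by blast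
qed

lemma affine_fun_convex_sum:
  assumes "affine_fun f" "finite S" "sum u S = 1"
  shows "f (\<Sum>s\<in>S. u s *\<^sub>R s) = (\<Sum>s\<in>S. u s * f s)"
proof -
  obtain l c where lc: "linear l" "f = (\<lambda>x. l x + c)" using assms(1) by (rule affine_funE)
  have "(\<Sum>s\<in>S. u s * f s) = (\<Sum>s\<in>S. u s * l s) + (\<Sum>s\<in>S. u s) * c"
    unfolding lc by (simp add: distrib_left sum.distrib sum_distrib_right)
  then show ?thesis using lc assms(3) by (simp add: linear_sum linear_scale)
qed

lemma affine_fun_eq_on_hull:
  assumes "affine_fun f" "affine_fun g" "\<And>s. s \<in> S \<Longrightarrow> f s = g s" "x \<in> affine hull S"
  shows "f x = g x"
proof -
  obtain l c where 1: "linear l" "f = (\<lambda>x. l x + c)" using assms(1) by (rule affine_funE)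
  obtain k d where 2: "linear k" "g = (\<lambda>x. k x + d)" using assms(2) by (rule affine_funE)
  have "affine {x. f x = g x}"
    unfolding affine_def 1 2
  proof (intro ballI allI impI, unfold mem_Collect_eq)
    fix x y and u v :: real
    assume *: "l x + c = k x + d" "l y + c = k y + d" "u + v = 1"
    have v: "v = 1 - u" using *(3) by linarith
    have "l (u *\<^sub>R x + v *\<^sub>R y) + c = u * (l x + c) + v * (l y + c)"
      unfolding linear_add[OF 1(1)] linear_scale[OF 1(1)] v by (simp add: algebra_simps)
    also have "\<dots> = u * (k x + d) + v * (k y + d)" using * by simp
    also have "\<dots> = k (u *\<^sub>R x + v *\<^sub>R y) + d"
      unfolding linear_add[OF 2(1)] linear_scale[OF 2(1)] v by (simp add: algebra_simps)
    finally show "l (u *\<^sub>R x + v *\<^sub>R y) + c = k (u *\<^sub>R x + v *\<^sub>R y) + d" .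
  qed
  then have "affine hull S \<subseteq> {x. f x = g x}"
    using assms(3) by (intro hull_minimal) auto
  then show ?thesis using assms(4) by auto
qed

text \<open>No topology is involved: after moving a point of \<open>S\<close> to the origin,
  \<open>x - a\<close> is independent of a maximal independent subset of the translate, so a linear
  functional can be prescribed as 1 there and 0 on that subset.\<close>

lemma affine_fun_separate:
  fixes x :: "'a::real_vector"
  assumes "x \<notin> affine hull S"
  obtains h where "affine_fun h" "\<And>s. s \<in> S \<Longrightarrow> h s = 0" "h x = 1"
proof (cases "S = {}")
  case True
  then show ?thesis using that[of "\<lambda>_. 1"] affine_fun_const by auto
next
  case False
  then obtain a where a: "a \<in> S" by blast
  let ?V = "(\<lambda>y. -a + y) ` S"
  have h: "affine hull S = (\<lambda>y. a + y) ` span ?V"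
    using affine_hull_span_gen[of a S] a by (simp add: hull_inc)
  have xn: "x - a \<notin> span ?V"
  proof
    assume "x - a \<in> span ?V"
    then have "a + (x - a) \<in> affine hull S" unfolding h by blast
    then show False using assms by simp
  qed
  obtain B where B: "B \<subseteq> ?V" "independent B" "?V \<subseteq> span B"
    using maximal_independent_subset by blast
  have "x - a \<notin> span B" using xn span_mono[OF B(1)] by blast
  then have ind: "independent (insert (x - a) B)" using B(2) independent_insertI by blast
  obtain l :: "'a \<Rightarrow> real" where l: "linear l" "\<forall>y\<in>insert (x - a) B. l y = (if y = x - a then 1 else 0)"
    using linear_independent_extend[OF ind, of "\<lambda>y. if y = x - a then 1 else 0"] by blast
  have z: "l y = 0" if "y \<in> span B" for y
  proof (rule linear_eq_0_on_span[OF l(1) _ that])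
    fix z assume "z \<in> B"
    then show "l z = 0" using l(2) \<open>x - a \<notin> span B\<close> span_base by fastforce
  qed
  show ?thesis
  proof (rule that[of "\<lambda>y. l y + - l a"])
    show "affine_fun (\<lambda>y. l y + - l a)" unfolding affine_fun_def using l(1) by blast
    show "l x + - l a = 1" using l by (simp flip: linear_diff)
    fix s assume "s \<in> S"
    then have "-a + s \<in> span B" using B(3) by blast
    then have "l (s - a) = 0" using z by simp
    then show "l s + - l a = 0" using l(1) by (simp add: linear_diff)
  qed
qed

text \<open>These are the functions spanning the extreme rays of the cone of affine functions that are
  nonnegative on \<open>S\<close>, considered up to equality on \<open>S\<close>.\<close>

definition extreme_fun :: "'a::real_vector set \<Rightarrow> ('a \<Rightarrow> real) \<Rightarrow> bool" where
  "extreme_fun S f \<longleftrightarrow> affine_fun f \<and> (\<forall>s\<in>S. f s \<ge> 0) \<and> (\<exists>s\<in>S. f s > 0) \<and>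
     (\<forall>h. affine_fun h \<longrightarrow> (\<forall>s\<in>S. f s = 0 \<longrightarrow> h s = 0) \<longrightarrow> (\<exists>c. \<forall>s\<in>S. h s = c * f s))"

text \<open>The ratio test: \<open>t\<close> is the minimum of \<open>f / h\<close> over the points
  with \<open>h > 0\<close>, the largest multiple of \<open>h\<close> whose subtraction keeps
  \<open>f\<close> nonnegative.\<close>

lemma exists_tight_multiple:
  fixes f h :: "'a \<Rightarrow> real"
  assumes "finite S" "\<And>s. s \<in> S \<Longrightarrow> f s \<ge> 0" "\<And>s. s \<in> S \<Longrightarrow> f s = 0 \<Longrightarrow> h s = 0"
    and "s1 \<in> S" "h s1 > 0"
  obtains t s2 where "t > 0" "\<And>s. s \<in> S \<Longrightarrow> f s - t * h s \<ge> 0" "s2 \<in> S" "h s2 > 0" "f s2 = t * h s2"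
proof -
  let ?P = "{s \<in> S. h s > 0}"
  have fin: "finite ((\<lambda>s. f s / h s) ` ?P)" and ne: "(\<lambda>s. f s / h s) ` ?P \<noteq> {}" using assms by auto
  define t where "t = Min ((\<lambda>s. f s / h s) ` ?P)"
  have "t \<in> (\<lambda>s. f s / h s) ` ?P" unfolding t_def using Min_in[OF fin ne] .
  then obtain s2 where s2: "s2 \<in> S" "h s2 > 0" "t = f s2 / h s2" by auto
  have "f s2 > 0" using assms(2)[OF s2(1)] assms(3)[OF s2(1)] s2(2) by force
  then have t0: "t > 0" using s2 by simp
  have "f s - t * h s \<ge> 0" if "s \<in> S" for s
  proof (cases "h s > 0")
    case True
    then have "t \<le> f s / h s" unfolding t_def using fin that by (intro Min_le) auto
    then show ?thesis using True by (simp add: field_simps)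
  next
    case False
    then have "t * h s \<le> 0" using t0 by (simp add: mult_nonneg_nonpos)
    then show ?thesis using assms(2)[OF that] by linarith
  qed
  then show ?thesis by (rule that[OF t0 _ s2(1,2)]) (use s2(2,3) in \<open>auto simp: field_simps\<close>)
qed

text \<open>Induction on the size of the support of \<open>f\<close>. A non-extreme \<open>f\<close>
  admits an \<open>h\<close> that vanishes where \<open>f\<close> does but is not proportional to
  it. Moving from \<open>f\<close> in direction \<open>-h\<close> until a value becomes zero gives
  \<open>p\<close> with smaller support. The rest \<open>q\<close> comes from moving in direction
  \<open>h\<close>, or is a multiple of \<open>h\<close> when \<open>h\<close> has no negative
  value.\<close>

lemma extreme_fun_decomposition:
  fixes f :: "'a::real_vector \<Rightarrow> real"
  assumes "finite S" "affine_fun f" "\<And>s. s \<in> S \<Longrightarrow> f s \<ge> 0"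
  shows "\<exists>fs. (\<forall>g\<in>set fs. extreme_fun S g) \<and> (\<forall>s\<in>S. f s = (\<Sum>g\<leftarrow>fs. g s))"
  using assms(2,3)
proof (induction "card {s \<in> S. f s \<noteq> 0}" arbitrary: f rule: less_induct)
  case less
  show ?case
  proof (cases "(\<forall>s\<in>S. f s = 0) \<or> extreme_fun S f")
    case True
    then show ?thesis
      by (elim disjE) (rule exI[of _ "[]"], simp, rule exI[of _ "[f]"], simp)
  next
    case False
    then obtain s0 where s0: "s0 \<in> S" "f s0 > 0" using less.prems by (metis less_eq_real_def)
    with False less.prems obtain h0 where h0: "affine_fun h0" "\<forall>s\<in>S. f s = 0 \<longrightarrow> h0 s = 0"
      "\<And>c. \<exists>s\<in>S. h0 s \<noteq> c * f s"
      unfolding extreme_fun_def by blast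
    \<comment> \<open>Cancelling \<open>h0\<close> at \<open>s0\<close>, where \<open>f\<close> is
      positive, ensures that in the case \<open>h \<ge> 0\<close> the multiple \<open>t * h\<close>
      has smaller support than \<open>f\<close>.\<close>
    define h1 where "h1 x = 1 * h0 x + (- h0 s0 / f s0) * f x" for x
    have h1: "affine_fun h1" unfolding h1_def[abs_def] by (intro affine_fun_combine h0 less.prems)
    have h1z: "h1 s = 0" if "s \<in> S" "f s = 0" for s using h0(2) that by (simp add: h1_def)
    have h1s0: "h1 s0 = 0" using s0 by (simp add: h1_def)
    obtain s1 where s1: "s1 \<in> S" "h1 s1 \<noteq> 0"
      using h0(3)[of "h0 s0 / f s0"] by (auto simp: h1_def)
    \<comment> \<open>The sign makes some value of \<open>h\<close> positive; the summand
      \<open>0 * h1 x\<close> only gives the term the shape of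
      \<open>affine_fun_combine\<close>.\<close>
    define h where "h x = (if h1 s1 > 0 then 1 else -1) * h1 x + 0 * h1 x" for x
    have ha: "affine_fun h" unfolding h_def[abs_def] by (intro affine_fun_combine h1)
    have hz: "h s = 0" if "s \<in> S" "f s = 0" for s using h1z that by (simp add: h_def)
    have hs0: "h s0 = 0" using h1s0 by (simp add: h_def)
    have hs1: "h s1 > 0" using s1 by (auto simp: h_def)
    obtain t s2 where t: "t > 0" "\<And>s. s \<in> S \<Longrightarrow> f s - t * h s \<ge> 0" "s2 \<in> S" "h s2 > 0" "f s2 = t * h s2"
      using exists_tight_multiple[where f = f and h = h, OF assms(1) less.prems(2) hz s1(1) hs1] by blast
    define p where "p x = 1 * f x + (- t) * h x" for x
    have pa: "affine_fun p" unfolding p_def[abs_def] by (intro affine_fun_combine less.prems ha)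
    have ppos: "p s \<ge> 0" if "s \<in> S" for s using t(2)[OF that] by (simp add: p_def)
    have "f s2 \<noteq> 0" using t by auto
    then have "{s \<in> S. p s \<noteq> 0} \<subset> {s \<in> S. f s \<noteq> 0}"
      using t(3,5) hz by (auto simp: p_def)
    then have pc: "card {s \<in> S. p s \<noteq> 0} < card {s \<in> S. f s \<noteq> 0}"
      using assms(1) by (intro psubset_card_mono) auto
    obtain ps where ps: "\<forall>g\<in>set ps. extreme_fun S g" "\<forall>s\<in>S. p s = (\<Sum>g\<leftarrow>ps. g s)"
      using less.hyps[OF pc pa ppos] by blast
    have "\<exists>q r. affine_fun q \<and> (\<forall>s\<in>S. q s \<ge> 0) \<and> r > 0 \<and> {s \<in> S. q s \<noteq> 0} \<subset> {s \<in> S. f s \<noteq> 0} \<and>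
        (\<forall>s\<in>S. f s = r * p s + q s)"
    proof (cases "\<exists>s\<in>S. h s < 0")
      case False
      define q where "q x = t * h x + 0 * h x" for x
      have "affine_fun q" unfolding q_def[abs_def] by (intro affine_fun_combine ha)
      moreover have "\<forall>s\<in>S. q s \<ge> 0" using False t(1) by (auto simp: q_def not_less)
      moreover have "{s \<in> S. q s \<noteq> 0} \<subset> {s \<in> S. f s \<noteq> 0}"
        using s0 hs0 hz by (auto simp: q_def)
      moreover have "\<forall>s\<in>S. f s = 1 * p s + q s" by (simp add: p_def q_def)
      ultimately show ?thesis by (intro exI[of _ q] exI[of _ "1::real"]) simp
    next
      case True
      then obtain s3 where s3: "s3 \<in> S" "- h s3 > 0" by auto
      have hzn: "- h s = 0" if "s \<in> S" "f s = 0" for s using hz that by simp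
      obtain t' s4 where t': "t' > 0" "\<And>s. s \<in> S \<Longrightarrow> f s - t' * - h s \<ge> 0" "s4 \<in> S" "- h s4 > 0" "f s4 = t' * - h s4"
        using exists_tight_multiple[where f = f and h = "\<lambda>x. - h x", OF assms(1) less.prems(2) hzn s3] by blast
      \<comment> \<open>With weights \<open>t' / (t + t')\<close> and \<open>t / (t + t')\<close>,
        \<open>f\<close> is a convex combination of \<open>f - t * h\<close> and
        \<open>f + t' * h\<close>.\<close>
      define r where "r = t' / (t + t')"
      define q where "q x = (t / (t + t')) * f x + (t * t' / (t + t')) * h x" for x
      have "affine_fun q" unfolding q_def[abs_def] by (intro affine_fun_combine ha less.prems)
      moreover have qe: "q x = (t / (t + t')) * (f x - t' * - h x)" for x
        by (simp add: q_def algebra_simps)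
      then have "\<forall>s\<in>S. q s \<ge> 0" using t(1) t'(1,2) by (simp del: mult_minus_right)
      moreover have "r > 0" using t(1) t'(1) by (simp add: r_def)
      moreover have "f s4 \<noteq> 0" "q s4 = 0" "\<And>s. s \<in> S \<Longrightarrow> f s = 0 \<Longrightarrow> q s = 0"
        using t' hz by (auto simp: qe)
      then have "{s \<in> S. q s \<noteq> 0} \<subset> {s \<in> S. f s \<noteq> 0}"
        using t'(3) by blast
      moreover have "f s = r * p s + q s" for s
      proof -
        have "t + t' \<noteq> 0" using t(1) t'(1) by linarith
        then show ?thesis unfolding r_def p_def q_def
          by (simp add: divide_simps) (simp add: algebra_simps)
      qed
      ultimately show ?thesis by blast
    qed
    then obtain q r where q: "affine_fun q" "\<forall>s\<in>S. q s \<ge> 0" "r > 0"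
      "{s \<in> S. q s \<noteq> 0} \<subset> {s \<in> S. f s \<noteq> 0}" "\<forall>s\<in>S. f s = r * p s + q s" by blast
    have qc: "card {s \<in> S. q s \<noteq> 0} < card {s \<in> S. f s \<noteq> 0}"
      using q(4) assms(1) by (intro psubset_card_mono) auto
    obtain qs where qs: "\<forall>g\<in>set qs. extreme_fun S g" "\<forall>s\<in>S. q s = (\<Sum>g\<leftarrow>qs. g s)"
      using less.hyps[OF qc q(1)] q(2) by blast
    let ?fs = "map (\<lambda>g x. r * g x + 0 * g x) ps @ qs"
    have "extreme_fun S (\<lambda>x. r * g x + 0 * g x)" if "extreme_fun S g" for g
    proof -
      have "\<exists>c. \<forall>s\<in>S. k s = c * (r * g s + 0 * g s)"
        if k: "affine_fun k" "\<forall>s\<in>S. r * g s + 0 * g s = 0 \<longrightarrow> k s = 0" for k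
      proof -
        have "\<forall>s\<in>S. g s = 0 \<longrightarrow> k s = 0" using k(2) by simp
        then obtain c where c: "\<forall>s\<in>S. k s = c * g s"
          using \<open>extreme_fun S g\<close> k(1) unfolding extreme_fun_def by blast
        then have "\<forall>s\<in>S. k s = (c / r) * (r * g s + 0 * g s)" using q(3) by simp
        then show ?thesis by blast
      qed
      moreover have "affine_fun (\<lambda>x. r * g x + 0 * g x)"
        using that unfolding extreme_fun_def by (intro affine_fun_combine) auto
      moreover have "\<forall>s\<in>S. r * g s + 0 * g s \<ge> 0" "\<exists>s\<in>S. r * g s + 0 * g s > 0"
        using that q(3) unfolding extreme_fun_def by (auto, metis zero_less_mult_iff)
      ultimately show ?thesis unfolding extreme_fun_def by blast
    qed
    then have "\<forall>g\<in>set ?fs. extreme_fun S g" using ps(1) qs(1) by auto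
    moreover have "\<forall>s\<in>S. f s = (\<Sum>g\<leftarrow>?fs. g s)"
      using q(5) ps(2) qs(2) by (simp add: o_def sum_list_const_mult)
    ultimately show ?thesis by blast
  qed
qed

lemma affine_fun_sum:
  assumes "finite A" "\<And>i. i \<in> A \<Longrightarrow> affine_fun (f i)"
  shows "affine_fun (\<lambda>x. \<Sum>i\<in>A. c i * f i x)"
  using assms
proof (induction A rule: finite_induct)
  case empty
  then show ?case using affine_fun_const by simp
next
  case (insert i A)
  then have "affine_fun (\<lambda>x. c i * f i x + 1 * (\<Sum>i\<in>A. c i * f i x))"
    by (intro affine_fun_combine) auto
  then show ?case using insert by simp
qed

section \<open>Faces and facets as zero sets\<close>

lemma affine_fun_nonneg_on_hull:
  assumes "finite S" "affine_fun f" "\<And>s. s \<in> S \<Longrightarrow> f s \<ge> 0" "x \<in> convex hull S"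
  shows "f x \<ge> 0"
proof -
  obtain u where u: "\<forall>s\<in>S. 0 \<le> u s" "sum u S = 1" "(\<Sum>s\<in>S. u s *\<^sub>R s) = x"
    using assms(4) convex_hull_finite[OF assms(1)] by blast
  have "f x = (\<Sum>s\<in>S. u s * f s)" using affine_fun_convex_sum[OF assms(2,1) u(2)] u(3) by simp
  then show ?thesis using u(1) assms(3) by (auto intro: sum_nonneg)
qed

lemma zero_set_subset_hull:
  fixes S :: "'a::real_vector set"
  assumes "finite S" "affine_fun f" "\<And>s. s \<in> S \<Longrightarrow> f s \<ge> 0"
  shows "{x \<in> convex hull S. f x = 0} \<subseteq> convex hull {s \<in> S. f s = 0}"
proof
  fix x assume "x \<in> {x \<in> convex hull S. f x = 0}"
  then have x: "x \<in> convex hull S" "f x = 0" by auto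
  obtain u where u: "\<forall>s\<in>S. 0 \<le> u s" "sum u S = 1" "(\<Sum>s\<in>S. u s *\<^sub>R s) = x"
    using x(1) convex_hull_finite[OF assms(1)] by blast
  have "(\<Sum>s\<in>S. u s * f s) = 0" using affine_fun_convex_sum[OF assms(2,1) u(2)] u(3) x(2) by simp
  then have z: "\<forall>s\<in>S. u s * f s = 0"
    using u(1) assms by (subst (asm) sum_nonneg_eq_0_iff) auto
  let ?Z = "{s \<in> S. f s = 0}"
  have "sum u ?Z = sum u S" using z assms(1) by (intro sum.mono_neutral_left) auto
  moreover have "(\<Sum>s\<in>?Z. u s *\<^sub>R s) = (\<Sum>s\<in>S. u s *\<^sub>R s)"
    using z assms(1) by (intro sum.mono_neutral_left) auto
  ultimately show "x \<in> convex hull ?Z"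
    using u assms(1) convex_hull_finite[of ?Z] by auto
qed

lemma zero_set_face_of:
  assumes "affine_fun f" "\<And>x. x \<in> C \<Longrightarrow> f x \<ge> 0" "convex C"
  shows "{x \<in> C. f x = 0} face_of C"
proof -
  obtain l c where lc: "linear l" "f = (\<lambda>x. l x + c)" using assms(1) by (rule affine_funE)
  have comb: "f (u *\<^sub>R x + v *\<^sub>R y) = u * f x + v * f y" if "u + v = 1" for u v x y
  proof -
    have v: "v = 1 - u" using that by simp
    show ?thesis unfolding lc linear_add[OF lc(1)] linear_scale[OF lc(1)] v by (simp add: algebra_simps)
  qed
  have "a \<in> {x \<in> C. f x = 0} \<and> b \<in> {x \<in> C. f x = 0}"
    if ab: "a \<in> C" "b \<in> C" "x \<in> {x \<in> C. f x = 0}" "x \<in> open_segment a b" for a b x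
  proof -
    obtain u where u: "0 < u" "u < 1" "x = (1 - u) *\<^sub>R a + u *\<^sub>R b"
      using ab(4) by (auto simp: in_segment)
    have "(1 - u) * f a + u * f b = 0" using comb[of "1 - u" u a b] u ab(3) by auto
    moreover have "(1 - u) * f a \<ge> 0" "u * f b \<ge> 0" using u assms(2) ab by auto
    ultimately have "(1 - u) * f a = 0" "u * f b = 0" by linarith+
    then show ?thesis using u ab by auto
  qed
  moreover have "convex {x \<in> C. f x = 0}"
    using assms(3) unfolding convex_def by (auto simp: comb)
  ultimately show ?thesis unfolding face_of_def by blast
qed

text \<open>An affine basis \<open>B\<close> of the zeros of \<open>f\<close> becomes one of
  \<open>S\<close> on adding a point \<open>s0\<close> with \<open>f s0 > 0\<close>: a point of
  \<open>S\<close> outside the larger hull could be separated by a function vanishing at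
  \<open>s0\<close> and at all zeros of \<open>f\<close>, which by extremality is a multiple of
  \<open>f\<close> and hence zero on \<open>S\<close>. The points \<open>a\<close> and
  \<open>b\<close> guarantee that zeros exist: otherwise both the constant 1 and a function
  separating \<open>a\<close> from \<open>b\<close> would be multiples of \<open>f\<close>.\<close>

lemma extreme_fun_facet:
  fixes S :: "'a::real_vector set"
  assumes S: "finite S" and f: "extreme_fun S f" and two: "a \<in> S" "b \<in> S" "a \<noteq> b"
  shows "is_facet_of {x \<in> convex hull S. f x = 0} (convex hull S)"
proof -
  let ?Z = "{s \<in> S. f s = 0}" and ?F = "{x \<in> convex hull S. f x = 0}"
  have af: "affine_fun f" and nn: "\<And>s. s \<in> S \<Longrightarrow> f s \<ge> 0"
    and ex: "\<And>h. affine_fun h \<Longrightarrow> (\<And>s. s \<in> S \<Longrightarrow> f s = 0 \<Longrightarrow> h s = 0) \<Longrightarrow> \<exists>c. \<forall>s\<in>S. h s = c * f s"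
    using f unfolding extreme_fun_def by blast+
  obtain s0 where s0: "s0 \<in> S" "f s0 > 0" using f unfolding extreme_fun_def by blast
  have "?F face_of convex hull S"
    using af affine_fun_nonneg_on_hull[OF S af nn] convex_convex_hull by (rule zero_set_face_of)
  moreover have Zne: "?Z \<noteq> {}"
  proof
    assume Z: "?Z = {}"
    obtain c1 where c1: "\<forall>s\<in>S. 1 = c1 * f s" using ex[OF affine_fun_const[of 1]] Z by auto
    have "b \<notin> affine hull {a}" unfolding hull_same[where S = affine, OF affine_sing] using two by auto
    then obtain h where h: "affine_fun h" "h a = 0" "h b = 1"
      by (metis affine_fun_separate singletonI)
    obtain c2 where c2: "\<forall>s\<in>S. h s = c2 * f s" using ex[OF h(1)] Z by auto
    then have "c2 = 0" using h(2) c1 two by auto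
    then show False using c2 h(3) two by auto
  qed
  then have "?F \<noteq> {}" using hull_inc[of _ S] by fastforce
  moreover have "affine_dim ?F = affine_dim (convex hull S) - 1"
  proof -
    obtain B where B: "B \<subseteq> ?Z" "\<not> affine_dependent B" "affine hull ?Z = affine hull B"
      using affine_basis_exists by blast
    have finB: "finite B" using finite_subset[OF B(1)] S by simp
    have s0B: "s0 \<notin> affine hull B"
    proof
      assume "s0 \<in> affine hull B"
      then have "f s0 = 0"
        by (rule affine_fun_eq_on_hull[OF af affine_fun_const[of 0], rotated]) (use B(1) in auto)
      then show False using s0 by simp
    qed
    have ind: "\<not> affine_dependent (insert s0 B)"
    proof -
      have "s0 \<notin> B" using s0B hull_inc by metis
      moreover have "B \<noteq> {}" using B(3) Zne by (metis affine_hull_eq_empty)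
      then obtain b where b: "b \<in> B" by blast
      let ?D = "(\<lambda>x. -b + x) ` (B - {b})"
      have "independent ?D" using B(2) b affine_dependent_iff_dependent2 by blast
      moreover have "-b + s0 \<notin> span ?D"
      proof
        assume "-b + s0 \<in> span ?D"
        then have "b + (-b + s0) \<in> affine hull B" using affine_hull_span2[OF b] by blast
        then show False using s0B by simp
      qed
      ultimately have "independent (insert (-b + s0) ?D)" by (intro independent_insertI)
      moreover have "insert (-b + s0) ?D = (\<lambda>x. -b + x) ` (insert s0 B - {b})"
        using \<open>s0 \<notin> B\<close> b by auto
      ultimately show ?thesis using affine_dependent_iff_dependent2[of b "insert s0 B"] b by auto
    qed
    have sub: "S \<subseteq> affine hull (insert s0 B)"
    proof (rule ccontr)
      assume "\<not> ?thesis"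
      then obtain s where s: "s \<in> S" "s \<notin> affine hull (insert s0 B)" by blast
      obtain h where h: "affine_fun h" "\<And>x. x \<in> insert s0 B \<Longrightarrow> h x = 0" "h s = 1"
        using affine_fun_separate[OF s(2)] by blast
      have "h x = 0" if "x \<in> S" "f x = 0" for x
      proof (rule affine_fun_eq_on_hull[OF h(1) affine_fun_const[of 0], of B])
        show "x \<in> affine hull B" using that B(3) hull_inc[of x ?Z] by auto
      qed (use h(2) in auto)
      then obtain c where c: "\<forall>s\<in>S. h s = c * f s" using ex[OF h(1)] by blast
      have "c = 0" using c s0 h(2)[of s0] by auto
      then show False using c s h(3) by auto
    qed
    have "affine hull (insert s0 B) = affine hull (convex hull S)"
    proof
      have "insert s0 B \<subseteq> affine hull (convex hull S)"
        using s0(1) B(1) hull_inc[of _ S affine] by auto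
      then show "affine hull (insert s0 B) \<subseteq> affine hull (convex hull S)"
        by (simp add: hull_minimal)
      show "affine hull (convex hull S) \<subseteq> affine hull (insert s0 B)"
        using sub by (simp add: hull_minimal)
    qed
    then have dS: "affine_dim (convex hull S) = int (card (insert s0 B)) - 1"
      using finB ind by (intro affine_dim_eqI) auto
    have "affine hull B = affine hull ?F"
    proof
      have "B \<subseteq> affine hull ?F"
        using B(1) hull_subset[of ?F affine] hull_subset[of S convex] by blast
      then show "affine hull B \<subseteq> affine hull ?F" by (simp add: hull_minimal)
      have "?F \<subseteq> affine hull B"
        using zero_set_subset_hull[OF S af nn] convex_hull_subset_affine_hull[of ?Z] B(3) by blast
      then show "affine hull ?F \<subseteq> affine hull B" by (simp add: hull_minimal)
    qed
    then have "affine_dim ?F = int (card B) - 1" using finB B(2) by (intro affine_dim_eqI) auto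
    moreover have "s0 \<notin> B" using s0B hull_inc by metis
    ultimately show ?thesis using dS finB by simp
  qed
  ultimately show ?thesis unfolding is_facet_of_def by blast
qed

text \<open>The core of Yannakakis' factorization: \<open>g F\<close> depends only on the facet and
  the point, \<open>c F\<close> only on the inequality \<open>f\<close>. One generator per facet
  suffices because extreme functions with the same zero set are proportional on
  \<open>S\<close>.\<close>

lemma slack_factorization:
  fixes S :: "'a::real_vector set"
  assumes S: "finite S" and two: "a \<in> S" "b \<in> S" "a \<noteq> b"
    and fin: "finite {F. is_facet_of F (convex hull S)}"
  obtains g where "\<And>F x. x \<in> convex hull S \<Longrightarrow> g F x \<ge> (0::real)"
    "\<And>f. affine_fun f \<Longrightarrow> (\<And>s. s \<in> S \<Longrightarrow> f s \<ge> 0) \<Longrightarrow>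
      \<exists>c. (\<forall>F. c F \<ge> 0) \<and> (\<forall>x\<in>convex hull S. f x = (\<Sum>F | is_facet_of F (convex hull S). c F * g F x))"
proof -
  let ?Q = "convex hull S" and ?Fs = "{F. is_facet_of F (convex hull S)}"
  let ?P = "\<lambda>F g. extreme_fun S g \<and> F = {x \<in> ?Q. g x = 0}"
  \<comment> \<open>The zero function is the default when no extreme function cuts out
    \<open>F\<close>; it keeps \<open>g F\<close> affine and nonnegative for every
    \<open>F\<close>.\<close>
  define g where "g F = (if \<exists>g. ?P F g then SOME g. ?P F g else (\<lambda>x. 0))" for F
  have gP: "?P F (g F)" if "?P F h" for F h
  proof -
    have "g F = (SOME g. ?P F g)" using that unfolding g_def by auto
    then show ?thesis using someI[of "?P F" h] that by simp
  qed
  have gaff: "affine_fun (g F)" and gnn: "\<And>s. s \<in> S \<Longrightarrow> g F s \<ge> 0" for F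
  proof -
    have "affine_fun (g F) \<and> (\<forall>s\<in>S. g F s \<ge> 0)"
    proof (cases "\<exists>h. ?P F h")
      case True
      then show ?thesis using gP unfolding extreme_fun_def by blast
    next
      case False
      then have "g F = (\<lambda>x. 0)" unfolding g_def by (rule if_not_P)
      then show ?thesis using affine_fun_const[of 0] by simp
    qed
    then show "affine_fun (g F)" "\<And>s. s \<in> S \<Longrightarrow> g F s \<ge> 0" by auto
  qed
  have single: "\<exists>F\<in>?Fs. \<exists>c\<ge>0. \<forall>s\<in>S. h s = c * g F s" if h: "extreme_fun S h" for h
  proof -
    let ?F = "{x \<in> ?Q. h x = 0}"
    have F: "?F \<in> ?Fs" using extreme_fun_facet[OF S h two] by simp
    have gF: "extreme_fun S (g ?F)" "?F = {x \<in> ?Q. g ?F x = 0}" using gP[of h ?F] h by auto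
    have "h s = 0" if "s \<in> S" "g ?F s = 0" for s
      using gF(2) that hull_inc[of s S convex] by blast
    then obtain c where c: "\<forall>s\<in>S. h s = c * g ?F s"
      using gF(1) h unfolding extreme_fun_def by blast
    obtain s where s: "s \<in> S" "g ?F s > 0" using gF(1) unfolding extreme_fun_def by blast
    have "h s \<ge> 0" using h s(1) unfolding extreme_fun_def by blast
    then have "c * g ?F s \<ge> 0" using c s(1) by simp
    then have "c \<ge> 0" using s(2) by (simp add: zero_le_mult_iff)
    then show ?thesis using F c by blast
  qed
  have list: "\<exists>c. (\<forall>F. c F \<ge> 0) \<and> (\<forall>s\<in>S. (\<Sum>h\<leftarrow>hs. h s) = (\<Sum>F\<in>?Fs. c F * g F s))"
    if "\<forall>h\<in>set hs. extreme_fun S h" for hs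
    using that
  proof (induction hs)
    case Nil
    then show ?case by (intro exI[of _ "\<lambda>F. 0"]) simp
  next
    case (Cons h hs)
    then obtain c where c: "\<forall>F. c F \<ge> 0" "\<forall>s\<in>S. (\<Sum>h\<leftarrow>hs. h s) = (\<Sum>F\<in>?Fs. c F * g F s)"
      by auto
    obtain G d where d: "G \<in> ?Fs" "d \<ge> 0" "\<forall>s\<in>S. h s = d * g G s"
      using single Cons.prems by (metis list.set_intros(1))
    let ?c = "\<lambda>F. c F + (if F = G then d else 0)"
    have "(\<Sum>F\<in>?Fs. ?c F * g F s) = (\<Sum>F\<in>?Fs. c F * g F s) + d * g G s" for s
    proof -
      have "(\<Sum>F\<in>?Fs. ?c F * g F s) = (\<Sum>F\<in>?Fs. c F * g F s + (if F = G then d * g F s else 0))"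
        by (intro sum.cong) (auto simp: algebra_simps)
      also have "\<dots> = (\<Sum>F\<in>?Fs. c F * g F s) + d * g G s"
        using fin d(1) by (simp add: sum.distrib)
      finally show ?thesis .
    qed
    then show ?case using c d by (intro exI[of _ ?c]) auto
  qed
  show ?thesis
  proof (rule that)
    show "g F x \<ge> 0" if "x \<in> ?Q" for F x
      using affine_fun_nonneg_on_hull[OF S gaff gnn that] .
    fix f :: "'a \<Rightarrow> real" assume f: "affine_fun f" "\<And>s. s \<in> S \<Longrightarrow> f s \<ge> 0"
    obtain hs where hs: "\<forall>h\<in>set hs. extreme_fun S h" "\<forall>s\<in>S. f s = (\<Sum>h\<leftarrow>hs. h s)"
      using extreme_fun_decomposition[OF S f] by blast
    obtain c where c: "\<forall>F. c F \<ge> 0" "\<forall>s\<in>S. (\<Sum>h\<leftarrow>hs. h s) = (\<Sum>F\<in>?Fs. c F * g F s)"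
      using list[OF hs(1)] by blast
    have "f x = (\<Sum>F\<in>?Fs. c F * g F x)" if "x \<in> ?Q" for x
    proof (rule affine_fun_eq_on_hull[OF f(1), of _ S])
      show "affine_fun (\<lambda>x. \<Sum>F\<in>?Fs. c F * g F x)" by (rule affine_fun_sum[OF fin gaff])
      show "x \<in> affine hull S" using that convex_hull_subset_affine_hull by blast
    qed (use hs c in auto)
    then show "\<exists>c. (\<forall>F. c F \<ge> 0) \<and> (\<forall>x\<in>?Q. f x = (\<Sum>F\<in>?Fs. c F * g F x))"
      using c(1) by blast
  qed
qed

text \<open>If \<open>s \<in> S\<close> has positive weight in \<open>x \<in> F\<close>, then
  \<open>x\<close> lies strictly between \<open>s\<close> and the renormalized rest \<open>y\<close>
  of the combination, and the face property puts \<open>s\<close> into \<open>F\<close>. In the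
  degenerate cases, weight 1 and \<open>s = y\<close>, the point \<open>x\<close> is
  \<open>s\<close> itself.\<close>

lemma face_of_finite_hull:
  fixes S :: "'a::real_vector set"
  assumes S: "finite S" and F: "F face_of convex hull S"
  shows "F = convex hull (F \<inter> S)"
proof
  have "F \<inter> S \<subseteq> F" "convex F" using F unfolding face_of_def by auto
  then show "convex hull (F \<inter> S) \<subseteq> F" by (rule hull_minimal)
  show "F \<subseteq> convex hull (F \<inter> S)"
  proof
    fix x assume x: "x \<in> F"
    then have "x \<in> convex hull S" using F unfolding face_of_def by blast
    then obtain u where u: "\<forall>s\<in>S. 0 \<le> u s" "sum u S = 1" "(\<Sum>s\<in>S. u s *\<^sub>R s) = x"
      using convex_hull_finite[OF S] by blast
    have sF: "s \<in> F" if s: "s \<in> S" "u s > 0" for s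
    proof -
      have sum1: "u s + sum u (S - {s}) = 1" using u(2) sum.remove[OF S s(1), of u] by simp
      have xs: "x = u s *\<^sub>R s + (\<Sum>t\<in>S - {s}. u t *\<^sub>R t)" using u(3) sum.remove[OF S s(1), of "\<lambda>t. u t *\<^sub>R t"] by simp
      show ?thesis
      proof (cases "u s = 1")
        case True
        then have "sum u (S - {s}) = 0" using sum1 by simp
        then have "\<forall>t\<in>S - {s}. u t = 0" using u(1) S by (subst (asm) sum_nonneg_eq_0_iff) auto
        then have "x = s" using xs True by simp
        then show ?thesis using x by simp
      next
        case False
        have "sum u (S - {s}) \<ge> 0" using u(1) by (intro sum_nonneg) auto
        then have lt: "u s < 1" using False sum1 by linarith
        define y where "y = (\<Sum>t\<in>S - {s}. (u t / (1 - u s)) *\<^sub>R t)"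
        have "(\<Sum>t\<in>S - {s}. u t / (1 - u s)) = 1"
          using sum1 lt by (simp flip: sum_divide_distrib)
        then have "y \<in> convex hull S"
          unfolding y_def using u(1) lt S
          by (intro convex_sum) (auto intro: hull_inc)
        moreover have "x = u s *\<^sub>R s + (1 - u s) *\<^sub>R y"
          unfolding y_def xs using lt by (simp add: scaleR_sum_right)
        ultimately show ?thesis
        proof (cases "s = y")
          case True
          then have "x = s" using \<open>x = u s *\<^sub>R s + (1 - u s) *\<^sub>R y\<close> by (simp flip: scaleR_left_distrib)
          then show ?thesis using x by simp
        next
          case False
          have "x \<in> open_segment y s"
            unfolding in_segment using False lt s(2) \<open>x = u s *\<^sub>R s + (1 - u s) *\<^sub>R y\<close>
            by (auto simp: algebra_simps intro!: exI[of _ "u s"])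
          then show ?thesis
            using F x \<open>y \<in> convex hull S\<close> hull_inc[OF s(1)] unfolding face_of_def by blast
        qed
      qed
    qed
    have "sum u (F \<inter> S) = sum u S" using sF u(1) S
      by (intro sum.mono_neutral_left) (auto simp: less_eq_real_def)
    moreover have "(\<Sum>s\<in>F \<inter> S. u s *\<^sub>R s) = (\<Sum>s\<in>S. u s *\<^sub>R s)"
      using sF u(1) S by (intro sum.mono_neutral_left) (auto simp: less_eq_real_def)
    ultimately show "x \<in> convex hull (F \<inter> S)"
      using u S convex_hull_finite[of "F \<inter> S"] by auto
  qed
qed

lemma finite_facets:
  fixes S :: "'a::real_vector set"
  assumes S: "finite S"
  shows "finite {F. is_facet_of F (convex hull S)}"
proof (rule finite_subset)
  show "{F. is_facet_of F (convex hull S)} \<subseteq> (\<lambda>T. convex hull T) ` Pow S"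
  proof
    fix F assume "F \<in> {F. is_facet_of F (convex hull S)}"
    then have "F = convex hull (F \<inter> S)" using face_of_finite_hull[OF S] unfolding is_facet_of_def by blast
    then show "F \<in> (\<lambda>T. convex hull T) ` Pow S" by blast
  qed
qed (use S in simp)

text \<open>The constant 1 is a sum of extreme functions; the sum cannot be empty, and each summand
  cuts out a facet.\<close>

lemma facet_exists:
  fixes S :: "'a::real_vector set"
  assumes S: "finite S" and two: "a \<in> S" "b \<in> S" "a \<noteq> b"
  shows "{F. is_facet_of F (convex hull S)} \<noteq> {}"
proof -
  obtain hs where hs: "\<forall>h\<in>set hs. extreme_fun S h" "\<forall>s\<in>S. 1 = (\<Sum>h\<leftarrow>hs. h s)"
    using extreme_fun_decomposition[OF S affine_fun_const[of 1]] by auto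
  then have "hs \<noteq> []" using two(1) by auto
  then obtain h where "h \<in> set hs" by (meson list.set_sel(1))
  then show ?thesis using extreme_fun_facet[OF S _ two, of h] hs(1) by blast
qed

text \<open>Excludes one-point extensions: a polytope with a positive number of facets has the two
  distinct points that \<open>slack_factorization\<close> asks for.\<close>

lemma facets_of_singleton: "\<not> is_facet_of F {x}"
proof
  assume F: "is_facet_of F {x}"
  then have "F = {x}" unfolding is_facet_of_def face_of_def by auto
  then show False using F unfolding is_facet_of_def by simp
qed

subsection \<open>Biased coordinates and hyperplane separation\<close>

text \<open>The exponential moment of a random sign. The sharp exponent would be
  \<open>x\<^sup>2 / 2\<close>; the weaker one only costs a constant in the rate.\<close>

lemma exp_add_exp_minus_le:
  fixes x :: real
  assumes "0 \<le> x" "x \<le> 1"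
  shows "exp x + exp (- x) \<le> 2 * exp (x\<^sup>2)"
proof -
  have "exp x \<le> 1 + x + x\<^sup>2" using exp_bound assms by simp
  moreover have "exp (- x) \<le> 1 - x + x\<^sup>2"
  proof -
    \<comment> \<open>The product of \<open>1 - x + x\<^sup>2\<close> with the quadratic Taylor
      polynomial of \<open>exp x\<close> is at least 1, and that polynomial is at most
      \<open>exp x\<close>.\<close>
    have "1 \<le> 1 + x\<^sup>2 / 2 + x ^ 3 / 2 + x ^ 4 / 2" using assms by simp
    also have "\<dots> = (1 - x + x\<^sup>2) * (1 + x + x\<^sup>2 / 2)"
      by (simp add: power2_eq_square power3_eq_cube power4_eq_xxxx field_simps)
    also have "\<dots> \<le> (1 - x + x\<^sup>2) * exp x"
      using assms exp_lower_Taylor_quadratic[of x] by (intro mult_left_mono) auto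
    finally show ?thesis by (simp add: exp_minus field_simps)
  qed
  moreover have "1 + x\<^sup>2 \<le> exp (x\<^sup>2)" by (rule exp_ge_add_one_self)
  ultimately show ?thesis by linarith
qed

lemma sum_Pow_insert:
  fixes f :: "'a set \<Rightarrow> 'b::comm_monoid_add"
  assumes "finite A" "x \<notin> A"
  shows "(\<Sum>a\<in>Pow (insert x A). f a) = (\<Sum>a\<in>Pow A. f a + f (insert x a))"
proof -
  have "inj_on (insert x) (Pow A)" using assms(2) by (auto simp: inj_on_def)
  moreover have "Pow A \<inter> insert x ` Pow A = {}" using assms(2) by auto
  ultimately show ?thesis
    using assms(1) by (simp add: Pow_insert sum.union_disjoint sum.reindex sum.distrib)
qed

text \<open>The moment generating function of a sum of independent signs factorizes over the
  coordinates.\<close>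

lemma sum_Pow_exp_le:
  fixes w :: "'i \<Rightarrow> real"
  assumes "finite I" "\<And>i. i \<in> I \<Longrightarrow> \<bar>w i\<bar> \<le> 1"
  shows "(\<Sum>a\<in>Pow I. exp (\<Sum>i\<in>I. if i \<in> a then w i else - w i))
    \<le> 2 ^ card I * exp (\<Sum>i\<in>I. (w i)\<^sup>2)"
  using assms
proof (induction I rule: finite_induct)
  case empty
  then show ?case by simp
next
  case (insert x I)
  let ?s = "\<lambda>I a. \<Sum>i\<in>I. if i \<in> a then w i else - w i"
  have two: "exp (w x) + exp (- w x) \<le> 2 * exp ((w x)\<^sup>2)"
    using exp_add_exp_minus_le[of "\<bar>w x\<bar>"] insert.prems[of x] by (cases "w x \<ge> 0") (auto simp: add.commute)
  have 1: "?s (insert x I) a = - w x + ?s I a" "?s (insert x I) (insert x a) = w x + ?s I a"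
    if "a \<subseteq> I" for a
  proof -
    have "x \<notin> a" using that insert by auto
    then show "?s (insert x I) a = - w x + ?s I a" using insert by simp
    have "?s I (insert x a) = ?s I a" using insert by (intro sum.cong) auto
    then show "?s (insert x I) (insert x a) = w x + ?s I a" using insert by simp
  qed
  have "(\<Sum>a\<in>Pow (insert x I). exp (?s (insert x I) a)) =
      (\<Sum>a\<in>Pow I. (exp (w x) + exp (- w x)) * exp (?s I a))"
    unfolding sum_Pow_insert[OF insert.hyps]
  proof (intro sum.cong refl)
    fix a assume "a \<in> Pow I"
    then show "exp (?s (insert x I) a) + exp (?s (insert x I) (insert x a)) =
        (exp (w x) + exp (- w x)) * exp (?s I a)"
      using 1[of a] by (simp only: Pow_iff exp_add) (simp add: algebra_simps)
  qed
  also have "\<dots> = (exp (w x) + exp (- w x)) * (\<Sum>a\<in>Pow I. exp (?s I a))"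
    by (simp add: sum_distrib_left)
  also have "\<dots> \<le> (2 * exp ((w x)\<^sup>2)) * (2 ^ card I * exp (\<Sum>i\<in>I. (w i)\<^sup>2))"
    using two insert by (intro mult_mono insert.IH) (auto intro: sum_nonneg)
  also have "\<dots> = 2 ^ card (insert x I) * exp (\<Sum>i\<in>insert x I. (w i)\<^sup>2)"
    using insert by (simp add: exp_add)
  finally show ?case .
qed

text \<open>Jensen's inequality for the exponential bounds the total weight of \<open>f\<close> by the exponential moment
  of the bias, so a function with many biased coordinates has exponentially small weight.\<close>

lemma biased_weight_bound:
  fixes f :: "'i set \<Rightarrow> real"
  assumes I: "finite I" "J \<subseteq> I" and f: "\<And>a. a \<subseteq> I \<Longrightarrow> 0 \<le> f a \<and> f a \<le> 1"
    and s: "\<bar>s\<bar> = 1" and c: "0 \<le> c" "c \<le> 1"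
    and bias: "\<And>i. i \<in> J \<Longrightarrow>
      c * (\<Sum>a\<in>Pow I. f a) \<le> s * ((\<Sum>a | a \<subseteq> I \<and> i \<in> a. f a) - (\<Sum>a | a \<subseteq> I \<and> i \<notin> a. f a))"
  shows "(\<Sum>a\<in>Pow I. f a) \<le> 2 ^ card I * exp (- (c\<^sup>2 / 4 * card J))"
proof -
  define W where "W = (\<Sum>a\<in>Pow I. f a)"
  \<comment> \<open>With weight \<open>s * c * z\<close> on \<open>J\<close>, the bias gains
    \<open>z * c\<^sup>2\<close> per coordinate and the moment bound costs
    \<open>z\<^sup>2 * c\<^sup>2\<close>; the difference is largest at
    \<open>z = 1/2\<close>.\<close>
  define w where "w i = (if i \<in> J then s * c / 2 else 0)" for i
  define S where "S a = (\<Sum>i\<in>I. if i \<in> a then w i else - w i)" for a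
  define t where "t = c\<^sup>2 / 2 * card J"
  have fin: "finite J" using I finite_subset by blast
  have eq: "(\<Sum>a\<in>Pow I. f a * (if i \<in> a then w i else - w i)) =
      w i * ((\<Sum>a | a \<subseteq> I \<and> i \<in> a. f a) - (\<Sum>a | a \<subseteq> I \<and> i \<notin> a. f a))" for i
  proof -
    have "(\<Sum>a\<in>Pow I. f a * (if i \<in> a then w i else - w i)) =
        (\<Sum>a\<in>Pow I. if i \<in> a then f a * w i else f a * - w i)"
      by (intro sum.cong) auto
    also have "\<dots> = (\<Sum>a\<in>Pow I \<inter> {a. i \<in> a}. f a * w i) + (\<Sum>a\<in>Pow I \<inter> - {a. i \<in> a}. f a * - w i)"
      using I(1) by (simp add: sum.If_cases)
    also have "Pow I \<inter> {a. i \<in> a} = {a. a \<subseteq> I \<and> i \<in> a}" by auto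
    also have "Pow I \<inter> - {a. i \<in> a} = {a. a \<subseteq> I \<and> i \<notin> a}" by auto
    finally show ?thesis by (simp add: right_diff_distrib sum_distrib_left sum_negf mult.commute)
  qed
  have "(\<Sum>a\<in>Pow I. f a * S a) = (\<Sum>i\<in>I. \<Sum>a\<in>Pow I. f a * (if i \<in> a then w i else - w i))"
    unfolding S_def sum_distrib_left by (rule sum.swap)
  also have "\<dots> = (\<Sum>i\<in>J. \<Sum>a\<in>Pow I. f a * (if i \<in> a then w i else - w i))"
    using I by (intro sum.mono_neutral_right) (auto simp: eq, auto simp: w_def)
  also have "\<dots> \<ge> (\<Sum>i\<in>J. c / 2 * (c * W))"
  proof (rule sum_mono)
    fix i assume "i \<in> J"
    then show "c / 2 * (c * W) \<le> (\<Sum>a\<in>Pow I. f a * (if i \<in> a then w i else - w i))"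
      unfolding eq using mult_left_mono[OF bias[of i], of "c / 2"] c
      by (simp add: w_def W_def mult_ac)
  qed
  finally have mean: "t * W \<le> (\<Sum>a\<in>Pow I. f a * S a)"
    by (simp add: t_def power2_eq_square mult_ac)
  \<comment> \<open>Jensen's inequality through the tangent of \<open>exp\<close> at
    \<open>t\<close>: the difference inserted here is nonnegative by \<open>mean\<close>, and the
    tangent value \<open>exp t * (1 + (S a - t))\<close> lies below
    \<open>exp (S a)\<close>.\<close>
  have "exp t * W \<le> exp t * (W + ((\<Sum>a\<in>Pow I. f a * S a) - t * W))" using mean by simp
  also have "\<dots> = (\<Sum>a\<in>Pow I. f a * (exp t * (1 + (S a - t))))"
    by (simp add: W_def algebra_simps sum.distrib sum_subtractf sum_distrib_left)
  also have "\<dots> \<le> (\<Sum>a\<in>Pow I. 1 * exp (S a))"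
  proof (rule sum_mono)
    fix a assume a: "a \<in> Pow I"
    have "exp t * (1 + (S a - t)) \<le> exp t * exp (S a - t)"
      by (intro mult_left_mono exp_ge_add_one_self) auto
    also have "\<dots> = exp (S a)" by (simp flip: exp_add)
    finally have "f a * (exp t * (1 + (S a - t))) \<le> f a * exp (S a)"
      using f a by (intro mult_left_mono) auto
    also have "\<dots> \<le> 1 * exp (S a)" using f a by (intro mult_right_mono) auto
    finally show "f a * (exp t * (1 + (S a - t))) \<le> 1 * exp (S a)" .
  qed
  also have "\<dots> \<le> 2 ^ card I * exp (\<Sum>i\<in>I. (w i)\<^sup>2)"
  proof -
    have "\<bar>w i\<bar> \<le> 1" for i using s c by (simp add: w_def abs_mult)
    then show ?thesis unfolding S_def using sum_Pow_exp_le[OF I(1), of w] by simp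
  qed
  also have "(\<Sum>i\<in>I. (w i)\<^sup>2) = (\<Sum>i\<in>J. c\<^sup>2 / 4)"
  proof -
    have "s\<^sup>2 = 1" using s by (metis power2_abs power_one)
    then have "(\<Sum>i\<in>J. (w i)\<^sup>2) = (\<Sum>i\<in>J. c\<^sup>2 / 4)"
      by (intro sum.cong) (auto simp: w_def power_mult_distrib power_divide)
    moreover have "(\<Sum>i\<in>I. (w i)\<^sup>2) = (\<Sum>i\<in>J. (w i)\<^sup>2)"
      using I by (intro sum.mono_neutral_right) (auto simp: w_def)
    ultimately show ?thesis by simp
  qed
  also have "\<dots> = t / 2" by (simp add: t_def)
  finally have main: "exp t * W \<le> 2 ^ card I * exp (t / 2)" .
  have "exp (- t) * exp t = 1" by (simp flip: exp_add)
  then have "W = exp (- t) * (exp t * W)" by (simp only: mult.assoc[symmetric])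
  also have "\<dots> \<le> exp (- t) * (2 ^ card I * exp (t / 2))"
    using main by (intro mult_left_mono) auto
  also have "\<dots> = 2 ^ card I * (exp (- t) * exp (t / 2))" by (rule mult.left_commute)
  also have "exp (- t) * exp (t / 2) = exp (- (c\<^sup>2 / 4 * card J))"
    by (simp add: t_def flip: exp_add)
  finally show ?thesis unfolding W_def .
qed

text \<open>Unless the weight of \<open>f\<close> is negligible, fewer than \<open>N / 1200\<close> of the \<open>N\<close> coordinates have
  \<open>n1 i > 11/10 * n0 i\<close> and fewer than \<open>N / 2\<close> have \<open>n1 i < n0 i / 2\<close>; this is where the rate
  \<open>1 / 3000000\<close> comes from.\<close>

lemma sum_biased_coordinates:
  fixes f :: "'i set \<Rightarrow> real"
  assumes I: "finite I" and f: "\<And>a. a \<subseteq> I \<Longrightarrow> 0 \<le> f a \<and> f a \<le> 1"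
  defines "n1 \<equiv> \<lambda>i. \<Sum>a | a \<subseteq> I \<and> i \<in> a. f a" and "n0 \<equiv> \<lambda>i. \<Sum>a | a \<subseteq> I \<and> i \<notin> a. f a"
  shows "(\<Sum>i | i \<in> I \<and> n1 i > 11/10 * n0 i. n1 i)
    \<le> 1/200 * (\<Sum>i\<in>I. n1 i) + real (card I) * 2 ^ card I * exp (- (card I / 3000000))"
proof -
  define W where "W = (\<Sum>a\<in>Pow I. f a)"
  define J where "J = {i \<in> I. n1 i > 11/10 * n0 i}"
  define K where "K = {i \<in> I. n1 i < n0 i / 2}"
  let ?N = "card I"
  have fin: "finite {a. a \<subseteq> I \<and> P a}" for P using I by simp
  have n1: "n1 i \<ge> 0" and n0: "n0 i \<ge> 0" for i
    unfolding n1_def n0_def by (intro sum_nonneg, simp add: f)+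
  have W: "n1 i + n0 i = W" for i
  proof -
    have "W = sum f ({a. a \<subseteq> I \<and> i \<in> a} \<union> {a. a \<subseteq> I \<and> i \<notin> a})"
      unfolding W_def by (intro sum.cong) auto
    also have "\<dots> = n1 i + n0 i" unfolding n1_def n0_def by (intro sum.union_disjoint fin) auto
    finally show ?thesis by simp
  qed
  have n1W: "n1 i \<le> W" for i using W[of i] n0[of i] by linarith
  have W0: "W \<ge> 0" unfolding W_def by (intro sum_nonneg) (simp add: f)
  have sub: "J \<subseteq> I" "K \<subseteq> I" unfolding J_def K_def by auto
  have finJ: "finite J" "finite K" using sub I finite_subset by blast+
  \<comment> \<open>The relative bias at the threshold 11/10 is (11/10 - 1) / (11/10 + 1) = 1/21;
    for \<open>K\<close>, the threshold 1/2 gives (1 - 1/2) / (1 + 1/2) = 1/3.\<close>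
  have bJ: "W \<le> 2 ^ ?N * exp (- ((1/21)\<^sup>2 / 4 * card J))"
    unfolding W_def
  proof (rule biased_weight_bound[OF I sub(1) f, where s = 1])
    fix i assume "i \<in> J"
    then have "n1 i > 11/10 * n0 i" by (simp add: J_def)
    then have "1 / 21 * W \<le> 1 * (n1 i - n0 i)" using W[of i, symmetric] by (simp add: field_simps)
    then show "1 / 21 * (\<Sum>a\<in>Pow I. f a) \<le> 1 * ((\<Sum>a | a \<subseteq> I \<and> i \<in> a. f a) - (\<Sum>a | a \<subseteq> I \<and> i \<notin> a. f a))"
      unfolding W_def n1_def n0_def .
  qed auto
  have bK: "W \<le> 2 ^ ?N * exp (- ((1/3)\<^sup>2 / 4 * card K))"
    unfolding W_def
  proof (rule biased_weight_bound[OF I sub(2) f, where s = "-1"])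
    fix i assume "i \<in> K"
    then have "n1 i < n0 i / 2" by (simp add: K_def)
    then have "1 / 3 * W \<le> - 1 * (n1 i - n0 i)" using W[of i, symmetric] by (simp add: field_simps)
    then show "1 / 3 * (\<Sum>a\<in>Pow I. f a) \<le> - 1 * ((\<Sum>a | a \<subseteq> I \<and> i \<in> a. f a) - (\<Sum>a | a \<subseteq> I \<and> i \<notin> a. f a))"
      unfolding W_def n1_def n0_def .
  qed auto
  have LHS: "(\<Sum>i\<in>J. n1 i) \<le> card J * W"
    using sum_bounded_above[of J n1 W] n1W by auto
  have pos: "(\<Sum>i\<in>I. n1 i) \<ge> 0" using n1 by (auto intro: sum_nonneg)
  have goal: "(\<Sum>i\<in>J. n1 i) \<le> 1/200 * (\<Sum>i\<in>I. n1 i) + real ?N * 2 ^ ?N * exp (- (?N / 3000000))"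
  proof (cases "W \<le> 2 ^ ?N * exp (- (?N / 3000000))")
    case True
    have "card J * W \<le> ?N * (2 ^ ?N * exp (- (?N / 3000000)))"
      using True W0 sub(1) I by (intro mult_mono) (auto intro: card_mono)
    then show ?thesis using LHS pos by (simp add: mult.assoc)
  next
    case False
    have "2 ^ ?N * exp (- (?N / 3000000)) < 2 ^ ?N * exp (- ((1/21)\<^sup>2 / 4 * card J))"
      using False bJ by linarith
    \<comment> \<open>Now \<open>card J\<close> is below 1764/3000000 of all coordinates, hence
      below 1/1200 of them. At least half of the coordinates lie outside \<open>K\<close> and have
      \<open>n1 i \<ge> W / 3\<close>, so the factor becomes (1/1200) / (1/6) = 1/200.\<close>
    then have J: "card J / 1764 < ?N / 3000000" by (simp add: power2_eq_square)
    have "2 ^ ?N * exp (- (?N / 3000000)) < 2 ^ ?N * exp (- ((1/3)\<^sup>2 / 4 * card K))"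
      using False bK by linarith
    then have K: "card K / 36 < ?N / 3000000" by (simp add: power2_eq_square)
    have "real (card (I - K)) = real ?N - card K" using sub(2) I finJ
      by (simp add: card_Diff_subset of_nat_diff card_mono)
    then have "real (card (I - K)) \<ge> ?N / 2" using K by linarith
    then have "?N / 2 * (W / 3) \<le> card (I - K) * (W / 3)" using W0 by (intro mult_right_mono) auto
    also have "\<dots> = (\<Sum>i\<in>I - K. W / 3)" by simp
    also have "\<dots> \<le> (\<Sum>i\<in>I - K. n1 i)"
    proof (rule sum_mono)
      fix i assume "i \<in> I - K"
      then have "n1 i \<ge> n0 i / 2" by (auto simp: K_def)
      then show "W / 3 \<le> n1 i" using W[of i] by linarith
    qed
    also have "\<dots> \<le> (\<Sum>i\<in>I. n1 i)" using I n1 by (intro sum_mono2) auto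
    finally have low: "?N / 2 * (W / 3) \<le> (\<Sum>i\<in>I. n1 i)" .
    have "card J * W \<le> (?N / 1200) * W" using J W0 by (intro mult_right_mono) auto
    also have "\<dots> = 1/200 * (?N / 2 * (W / 3))" by simp
    also have "\<dots> \<le> 1/200 * (\<Sum>i\<in>I. n1 i)" using low by (intro mult_left_mono) auto
    finally have "(\<Sum>i\<in>J. n1 i) \<le> 1/200 * (\<Sum>i\<in>I. n1 i)" using LHS by linarith
    moreover have "real ?N * 2 ^ ?N * exp (- (?N / 3000000)) \<ge> 0" by simp
    ultimately show ?thesis by linarith
  qed
  then show ?thesis unfolding J_def .
qed

section \<open>Averaging over interchangeable gadgets\<close>

lemma sum_containing_swap:
  fixes f :: "nat set \<Rightarrow> real"
  assumes "i < N"
  shows "(\<Sum>a | a \<subseteq> {..<N} \<and> 0 \<in> a. f (Transposition.transpose 0 i ` a)) = (\<Sum>a | a \<subseteq> {..<N} \<and> i \<in> a. f a)"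
    and "(\<Sum>a | a \<subseteq> {..<N} \<and> 0 \<notin> a. f (Transposition.transpose 0 i ` a)) = (\<Sum>a | a \<subseteq> {..<N} \<and> i \<notin> a. f a)"
proof -
  have inv: "Transposition.transpose 0 i ` Transposition.transpose 0 i ` a = a" for a :: "nat set"
    by (simp add: image_comp)
  have sub: "Transposition.transpose 0 i ` a \<subseteq> {..<N}" if "a \<subseteq> {..<N}" for a
  proof -
    have "Transposition.transpose 0 i permutes {..<N}" using assms by (intro permutes_swap_id) auto
    then show ?thesis using that permutes_image by blast
  qed
  show "(\<Sum>a | a \<subseteq> {..<N} \<and> 0 \<in> a. f (Transposition.transpose 0 i ` a)) = (\<Sum>a | a \<subseteq> {..<N} \<and> i \<in> a. f a)"
    by (rule sum.reindex_bij_witness[of _ "\<lambda>a. Transposition.transpose 0 i ` a" "\<lambda>a. Transposition.transpose 0 i ` a"])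
      (auto simp: inv sub in_transpose_image_iff)
  show "(\<Sum>a | a \<subseteq> {..<N} \<and> 0 \<notin> a. f (Transposition.transpose 0 i ` a)) = (\<Sum>a | a \<subseteq> {..<N} \<and> i \<notin> a. f a)"
    by (rule sum.reindex_bij_witness[of _ "\<lambda>a. Transposition.transpose 0 i ` a" "\<lambda>a. Transposition.transpose 0 i ` a"])
      (auto simp: inv sub in_transpose_image_iff)
qed

text \<open>Double counting: \<open>s i\<close> exchanges the roles of the coordinates 0 and
  \<open>i\<close> and preserves the weight \<open>w\<close>. Summed over \<open>i < N\<close>, the
  event that coordinate 0 is biased turns into the biased coordinates of each single
  \<open>g\<close>, which \<open>sum_biased_coordinates\<close> controls.\<close>

lemma sum_biased_orbits:
  fixes G :: "'g set" and f :: "'g \<Rightarrow> nat set \<Rightarrow> real" and w :: "'g \<Rightarrow> real" and s :: "nat \<Rightarrow> 'g \<Rightarrow> 'g" and C :: real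
  assumes G: "finite G" and N: "N > 0"
    and s: "\<And>i. i < N \<Longrightarrow> bij_betw (s i) G G"
    and f: "\<And>g a. g \<in> G \<Longrightarrow> 0 \<le> f g a \<and> f g a \<le> 1"
    and w: "\<And>g. g \<in> G \<Longrightarrow> 0 \<le> w g \<and> w g \<le> C"
    and fs: "\<And>i g a. i < N \<Longrightarrow> g \<in> G \<Longrightarrow> a \<subseteq> {..<N} \<Longrightarrow> f (s i g) a = f g (Transposition.transpose 0 i ` a)"
    and ws: "\<And>i g. i < N \<Longrightarrow> g \<in> G \<Longrightarrow> w (s i g) = w g"
  defines "f1 \<equiv> \<lambda>g. \<Sum>a | a \<subseteq> {..<N} \<and> 0 \<in> a. f g a" and "f0 \<equiv> \<lambda>g. \<Sum>a | a \<subseteq> {..<N} \<and> 0 \<notin> a. f g a"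
  shows "(\<Sum>g | g \<in> G \<and> f1 g > 11/10 * f0 g. f1 g * w g)
    \<le> 1/200 * (\<Sum>g\<in>G. f1 g * w g) + real (card G) * C * 2 ^ N * exp (- (N / 3000000))"
proof -
  define n1 where "n1 g i = (\<Sum>a | a \<subseteq> {..<N} \<and> i \<in> a. f g a)" for g i
  define n0 where "n0 g i = (\<Sum>a | a \<subseteq> {..<N} \<and> i \<notin> a. f g a)" for g i
  define err where "err = real N * 2 ^ N * exp (- (N / 3000000))"
  have f1s: "f1 (s i g) = n1 g i" and f0s: "f0 (s i g) = n0 g i" if "i < N" "g \<in> G" for i g
    using sum_containing_swap[OF that(1), of "f g"] fs[OF that]
    by (simp_all add: f1_def f0_def n1_def n0_def)
  have reindex: "(\<Sum>g\<in>G. F g) = (\<Sum>g\<in>G. F (s i g))" if "i < N" for i and F :: "'g \<Rightarrow> real"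
    using sum.reindex_bij_betw[OF s[OF that]] by metis
  let ?bad = "\<lambda>g. if f1 g > 11/10 * f0 g then f1 g * w g else 0"
  have "N * (\<Sum>g | g \<in> G \<and> f1 g > 11/10 * f0 g. f1 g * w g) = (\<Sum>i<N. \<Sum>g\<in>G. ?bad g)"
    using G by (simp add: sum.inter_filter)
  also have "\<dots> = (\<Sum>i<N. \<Sum>g\<in>G. ?bad (s i g))"
    by (rule sum.cong[OF refl], rule reindex[where F = ?bad]) simp
  also have "\<dots> = (\<Sum>i<N. \<Sum>g\<in>G. w g * (if n1 g i > 11/10 * n0 g i then n1 g i else 0))"
    by (intro sum.cong refl) (auto simp: f1s f0s ws)
  also have "\<dots> = (\<Sum>g\<in>G. \<Sum>i<N. w g * (if n1 g i > 11/10 * n0 g i then n1 g i else 0))"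
    by (rule sum.swap)
  also have "\<dots> = (\<Sum>g\<in>G. w g * (\<Sum>i | i \<in> {..<N} \<and> n1 g i > 11/10 * n0 g i. n1 g i))"
  proof (intro sum.cong refl)
    fix g
    have "(\<Sum>i | i \<in> {..<N} \<and> n1 g i > 11/10 * n0 g i. n1 g i)
        = (\<Sum>i<N. if n1 g i > 11/10 * n0 g i then n1 g i else 0)"
      by (rule sum.inter_filter) simp
    then show "(\<Sum>i<N. w g * (if n1 g i > 11/10 * n0 g i then n1 g i else 0))
        = w g * (\<Sum>i | i \<in> {..<N} \<and> n1 g i > 11/10 * n0 g i. n1 g i)"
      by (simp add: sum_distrib_left)
  qed
  also have "\<dots> \<le> (\<Sum>g\<in>G. w g * (1/200 * (\<Sum>i<N. n1 g i) + err))"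
  proof (intro sum_mono mult_left_mono)
    fix g assume g: "g \<in> G"
    then show "(\<Sum>i | i \<in> {..<N} \<and> n1 g i > 11/10 * n0 g i. n1 g i) \<le> 1/200 * (\<Sum>i<N. n1 g i) + err"
      using sum_biased_coordinates[of "{..<N}" "f g"] f unfolding n1_def n0_def err_def by simp
  qed (use w in auto)
  also have "\<dots> = 1/200 * (\<Sum>i<N. \<Sum>g\<in>G. n1 g i * w g) + (\<Sum>g\<in>G. w g) * err"
    by (subst sum.swap) (simp add: algebra_simps sum.distrib sum_distrib_left sum_distrib_right)
  also have "(\<Sum>i<N. \<Sum>g\<in>G. n1 g i * w g) = (\<Sum>i<N. \<Sum>g\<in>G. f1 (s i g) * w (s i g))"
    by (intro sum.cong refl) (auto simp: f1s ws)
  also have "\<dots> = (\<Sum>i<N. \<Sum>g\<in>G. f1 g * w g)"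
    by (rule sum.cong[OF refl], rule reindex[where F = "\<lambda>g. f1 g * w g", symmetric]) simp
  also have "\<dots> = N * (\<Sum>g\<in>G. f1 g * w g)" by simp
  finally have "N * (\<Sum>g | g \<in> G \<and> f1 g > 11/10 * f0 g. f1 g * w g)
      \<le> 1/200 * (N * (\<Sum>g\<in>G. f1 g * w g)) + (\<Sum>g\<in>G. w g) * err" .
  also have "\<dots> \<le> 1/200 * (N * (\<Sum>g\<in>G. f1 g * w g)) + (card G * C) * err"
    using sum_bounded_above[of G w C] w by (intro add_left_mono mult_right_mono) (auto simp: err_def)
  also have "\<dots> = N * (1/200 * (\<Sum>g\<in>G. f1 g * w g) + real (card G) * C * 2 ^ N * exp (- (N / 3000000)))"
    by (simp add: err_def algebra_simps)
  finally show ?thesis using N by simp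
qed

text \<open>The five points of an orbit, joined when they differ by two rotation steps, form a 5-cycle, whose
  independent sets have at most two elements.\<close>

lemma sum_rotation_le:
  fixes G :: "'g set" and p :: "'g \<Rightarrow> real"
  assumes G: "finite G" and r: "bij_betw r G G"
    and r5: "\<And>g. g \<in> G \<Longrightarrow> r (r (r (r (r g)))) = g"
    and p: "\<And>g. g \<in> G \<Longrightarrow> 0 \<le> p g" "\<And>g. g \<in> G \<Longrightarrow> p (r g) = p g"
    and T: "\<And>g. g \<in> G \<Longrightarrow> \<not> (T g \<and> T (r (r g)))"
  shows "(\<Sum>g | g \<in> G \<and> T g. p g) \<le> 2/5 * (\<Sum>g\<in>G. p g)"
proof -
  let ?t = "\<lambda>g. of_bool (T g) :: real"
  define S where "S F = (\<Sum>g\<in>G. p g * F g)" for F :: "'g \<Rightarrow> real"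
  have rG: "r g \<in> G" if "g \<in> G" for g using bij_betw_apply[OF r that] .
  have shift: "S (\<lambda>g. F (r g)) = S F" for F
  proof -
    have "S F = (\<Sum>g\<in>G. p (r g) * F (r g))"
      unfolding S_def using sum.reindex_bij_betw[OF r, of "\<lambda>g. p g * F g"] by simp
    also have "\<dots> = S (\<lambda>g. F (r g))" unfolding S_def using p(2) by (intro sum.cong) auto
    finally show ?thesis by simp
  qed
  have "(\<Sum>g | g \<in> G \<and> T g. p g) = S ?t"
    unfolding S_def using G by (simp add: sum.inter_filter of_bool_def if_distrib cong: if_cong)
  moreover have "5 * S ?t = S (\<lambda>g. ?t g + ?t (r g) + ?t (r (r g)) + ?t (r (r (r g))) + ?t (r (r (r (r g)))))"
  proof -
    have "S (\<lambda>g. ?t (r (r (r (r g))))) = S ?t" "S (\<lambda>g. ?t (r (r (r g)))) = S ?t"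
      "S (\<lambda>g. ?t (r (r g))) = S ?t" "S (\<lambda>g. ?t (r g)) = S ?t"
      using shift[of "\<lambda>g. ?t (r (r (r g)))"] shift[of "\<lambda>g. ?t (r (r g))"] shift[of "\<lambda>g. ?t (r g)"]
        shift[of ?t] by simp_all
    then show ?thesis unfolding S_def by (simp add: distrib_left sum.distrib)
  qed
  moreover have "\<dots> \<le> S (\<lambda>g. 2)"
    unfolding S_def
  proof (intro sum_mono mult_left_mono)
    fix g assume g: "g \<in> G"
    have 1: "\<not> (T (r g) \<and> T (r (r (r g))))" "\<not> (T (r (r g)) \<and> T (r (r (r (r g)))))"
      "\<not> (T (r (r (r g))) \<and> T g)" "\<not> (T (r (r (r (r g)))) \<and> T (r g))" "\<not> (T g \<and> T (r (r g)))"
      using T[of g] T[of "r g"] T[of "r (r g)"] T[of "r (r (r g))"] T[of "r (r (r (r g)))"] r5 rG g by metis+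
    then show "?t g + ?t (r g) + ?t (r (r g)) + ?t (r (r (r g))) + ?t (r (r (r (r g)))) \<le> 2"
      by (auto simp: of_bool_def)
  qed (use p in auto)
  ultimately show ?thesis unfolding S_def by (simp flip: sum_distrib_right)
qed

text \<open>\<open>f\<close> is the cut factor and \<open>h\<close> the matching factor of a
  rank-one term. By \<open>hs\<close> and \<open>ft\<close>, swapping gadgets on one side leaves the
  weight from the other side unchanged, so the biased part of either side is small. Elsewhere
  \<open>f1 * h1\<close> is at most \<open>121/100 * (f0 * h0)\<close>, and since the rotation
  preserves \<open>f0\<close> and \<open>h0\<close>, \<open>conflict\<close> lets at most 2/5 of the
  total of \<open>f0 * h0\<close> sit where \<open>f1 * h1\<close> is nonzero.\<close>

lemma hyperplane_bound:
  fixes G :: "'g set" and f h :: "'g \<Rightarrow> nat set \<Rightarrow> real" and s t :: "nat \<Rightarrow> 'g \<Rightarrow> 'g"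
  assumes G: "finite G" and N: "N > 0"
    and s: "\<And>i. i < N \<Longrightarrow> bij_betw (s i) G G" and t: "\<And>i. i < N \<Longrightarrow> bij_betw (t i) G G"
    and r: "bij_betw r G G" "\<And>g. g \<in> G \<Longrightarrow> r (r (r (r (r g)))) = g"
    and f: "\<And>g a. g \<in> G \<Longrightarrow> 0 \<le> f g a \<and> f g a \<le> 1" and h: "\<And>g a. g \<in> G \<Longrightarrow> 0 \<le> h g a \<and> h g a \<le> 1"
    and fs: "\<And>i g a. i < N \<Longrightarrow> g \<in> G \<Longrightarrow> a \<subseteq> {..<N} \<Longrightarrow> f (s i g) a = f g (Transposition.transpose 0 i ` a)"
    and hs: "\<And>i g a. i < N \<Longrightarrow> g \<in> G \<Longrightarrow> a \<subseteq> {..<N} \<Longrightarrow> 0 \<in> a \<Longrightarrow> h (s i g) a = h g a"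
    and ht: "\<And>i g a. i < N \<Longrightarrow> g \<in> G \<Longrightarrow> a \<subseteq> {..<N} \<Longrightarrow> h (t i g) a = h g (Transposition.transpose 0 i ` a)"
    and ft: "\<And>i g a. i < N \<Longrightarrow> g \<in> G \<Longrightarrow> a \<subseteq> {..<N} \<Longrightarrow> 0 \<in> a \<Longrightarrow> f (t i g) a = f g a"
    and fr: "\<And>g a. g \<in> G \<Longrightarrow> a \<subseteq> {..<N} \<Longrightarrow> 0 \<notin> a \<Longrightarrow> f (r g) a = f g a"
    and hr: "\<And>g a. g \<in> G \<Longrightarrow> a \<subseteq> {..<N} \<Longrightarrow> 0 \<notin> a \<Longrightarrow> h (r g) a = h g a"
    and conflict: "\<And>g a b. g \<in> G \<Longrightarrow> a \<subseteq> {..<N} \<Longrightarrow> b \<subseteq> {..<N} \<Longrightarrow> 0 \<in> a \<Longrightarrow> 0 \<in> b \<Longrightarrow>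
      f g a * h (r (r g)) b = 0"
  defines "f1 \<equiv> \<lambda>g. \<Sum>a | a \<subseteq> {..<N} \<and> 0 \<in> a. f g a" and "f0 \<equiv> \<lambda>g. \<Sum>a | a \<subseteq> {..<N} \<and> 0 \<notin> a. f g a"
    and "h1 \<equiv> \<lambda>g. \<Sum>a | a \<subseteq> {..<N} \<and> 0 \<in> a. h g a" and "h0 \<equiv> \<lambda>g. \<Sum>a | a \<subseteq> {..<N} \<and> 0 \<notin> a. h g a"
  shows "(\<Sum>g\<in>G. f1 g * h1 g) \<le> 49/100 * (\<Sum>g\<in>G. f0 g * h0 g) + 3 * real (card G) * 4 ^ N * exp (- (N / 3000000))"
proof -
  let ?err = "real (card G) * 2 ^ N * 2 ^ N * exp (- (N / 3000000))"
  have fin: "finite {a. a \<subseteq> {..<N} \<and> P a}" for P by simp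
  have nonneg: "f1 g \<ge> 0" "f0 g \<ge> 0" "h1 g \<ge> 0" "h0 g \<ge> 0" if "g \<in> G" for g
    using f h that unfolding f1_def f0_def h1_def h0_def by (auto intro: sum_nonneg)
  have le: "(\<Sum>a | a \<subseteq> {..<N} \<and> P a. F a) \<le> 2 ^ N" if "\<And>a. 0 \<le> F a \<and> F a \<le> 1" for P and F :: "nat set \<Rightarrow> real"
  proof -
    have "(\<Sum>a | a \<subseteq> {..<N} \<and> P a. F a) \<le> real (card {a. a \<subseteq> {..<N} \<and> P a}) * 1"
      using that by (intro sum_bounded_above) auto
    also have "card {a. a \<subseteq> {..<N} \<and> P a} \<le> card (Pow {..<N})" by (intro card_mono) auto
    finally show ?thesis by (simp add: card_Pow)
  qed
  have badA: "(\<Sum>g | g \<in> G \<and> f1 g > 11/10 * f0 g. f1 g * h1 g) \<le> 1/200 * (\<Sum>g\<in>G. f1 g * h1 g) + ?err"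
    unfolding f1_def f0_def
  proof (rule sum_biased_orbits[where f = f and w = h1 and C = "2 ^ N", OF G N s f _ fs])
    fix g assume "g \<in> G"
    then show "0 \<le> h1 g \<and> h1 g \<le> 2 ^ N" using nonneg le[of "h g"] h unfolding h1_def by auto
  next
    fix i g assume "i < N" "g \<in> G"
    then show "h1 (s i g) = h1 g" unfolding h1_def by (intro sum.cong refl hs) auto
  qed
  have badB: "(\<Sum>g | g \<in> G \<and> h1 g > 11/10 * h0 g. h1 g * f1 g) \<le> 1/200 * (\<Sum>g\<in>G. h1 g * f1 g) + ?err"
    unfolding h1_def h0_def
  proof (rule sum_biased_orbits[where f = h and w = f1 and C = "2 ^ N", OF G N t h _ ht])
    fix g assume "g \<in> G"
    then show "0 \<le> f1 g \<and> f1 g \<le> 2 ^ N" using nonneg le[of "f g"] f unfolding f1_def by auto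
  next
    fix i g assume "i < N" "g \<in> G"
    then show "f1 (t i g) = f1 g" unfolding f1_def by (intro sum.cong refl ft) auto
  qed
  have comm: "(\<Sum>g\<in>G. h1 g * f1 g) = (\<Sum>g\<in>G. f1 g * h1 g)" by (simp add: mult.commute)
  define T where "T g \<longleftrightarrow> f1 g * h1 g \<noteq> 0" for g
  have rG: "r g \<in> G" if "g \<in> G" for g using bij_betw_apply[OF r(1) that] .
  have rot: "(\<Sum>g | g \<in> G \<and> T g. f0 g * h0 g) \<le> 2/5 * (\<Sum>g\<in>G. f0 g * h0 g)"
  proof (rule sum_rotation_le[OF G r])
    fix g assume g: "g \<in> G"
    show "0 \<le> f0 g * h0 g" using nonneg g by simp
    have "f0 (r g) = f0 g" unfolding f0_def by (intro sum.cong refl fr g) auto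
    moreover have "h0 (r g) = h0 g" unfolding h0_def by (intro sum.cong refl hr g) auto
    ultimately show "f0 (r g) * h0 (r g) = f0 g * h0 g" by simp
    have "f1 g * h1 (r (r g)) = 0"
      unfolding f1_def h1_def sum_product using conflict g by (intro sum.neutral ballI) auto
    then show "\<not> (T g \<and> T (r (r g)))" unfolding T_def by auto
  qed
  have "(\<Sum>g\<in>G. f1 g * h1 g) \<le> (\<Sum>g\<in>G. 121/100 * (if T g then f0 g * h0 g else 0)
      + (if f1 g > 11/10 * f0 g then f1 g * h1 g else 0) + (if h1 g > 11/10 * h0 g then h1 g * f1 g else 0))"
  proof (rule sum_mono)
    fix g assume g: "g \<in> G"
    have "f1 g * h1 g \<le> (11/10 * f0 g) * (11/10 * h0 g)" if "f1 g \<le> 11/10 * f0 g" "h1 g \<le> 11/10 * h0 g"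
      using that nonneg g by (intro mult_mono) auto
    moreover have "f1 g * h1 g \<ge> 0" "f0 g * h0 g \<ge> 0" using nonneg g by auto
    ultimately show "f1 g * h1 g \<le> 121/100 * (if T g then f0 g * h0 g else 0)
        + (if f1 g > 11/10 * f0 g then f1 g * h1 g else 0) + (if h1 g > 11/10 * h0 g then h1 g * f1 g else 0)"
      unfolding T_def by (auto simp: mult.commute)
  qed
  also have "\<dots> = 121/100 * (\<Sum>g | g \<in> G \<and> T g. f0 g * h0 g)
      + (\<Sum>g | g \<in> G \<and> f1 g > 11/10 * f0 g. f1 g * h1 g) + (\<Sum>g | g \<in> G \<and> h1 g > 11/10 * h0 g. h1 g * f1 g)"
    using G by (simp add: sum.distrib sum.inter_filter sum_distrib_left)
  also have "\<dots> \<le> 121/100 * (2/5 * (\<Sum>g\<in>G. f0 g * h0 g)) + (1/200 * (\<Sum>g\<in>G. f1 g * h1 g) + ?err)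
      + (1/200 * (\<Sum>g\<in>G. f1 g * h1 g) + ?err)"
    using badA badB[unfolded comm] rot by linarith
  \<comment> \<open>121/100 times 2/5 is 484/1000, and the two terms with factor 1/200 move to the
    left. Dividing by 99/100 leaves 484/990 < 49/100 and 200/99 < 3.\<close>
  finally have "99/100 * (\<Sum>g\<in>G. f1 g * h1 g) \<le> 484/1000 * (\<Sum>g\<in>G. f0 g * h0 g) + 2 * ?err" by simp
  moreover have "(\<Sum>g\<in>G. f0 g * h0 g) \<ge> 0" using nonneg by (intro sum_nonneg) auto
  moreover have "?err \<ge> 0" by simp
  ultimately have "(\<Sum>g\<in>G. f1 g * h1 g) \<le> 49/100 * (\<Sum>g\<in>G. f0 g * h0 g) + 3 * ?err" by linarith
  moreover have "(2::real) ^ N * 2 ^ N = 4 ^ N" by (simp flip: power_mult_distrib)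
  ultimately show ?thesis by (simp add: mult.assoc)
qed

subsection \<open>Violated edges of perfect matchings\<close>

definition violated :: "vertex set \<Rightarrow> edge \<Rightarrow> bool" where
  "violated X e \<longleftrightarrow> (case e of (u, v, c) \<Rightarrow> (c = Red) \<noteq> ((Inl u \<in> X) \<noteq> (Inr v \<in> X)))"

definition viol :: "vertex set \<Rightarrow> edge set \<Rightarrow> nat" where
  "viol X M = card {e \<in> M. violated X e}"

definition reds :: "edge set \<Rightarrow> nat" where
  "reds M = card {e \<in> M. edge_color e = Red}"

lemma sum_of_bool_eq_card:
  assumes "finite A"
  shows "(\<Sum>x\<in>A. of_bool (P x)) = card {x \<in> A. P x}"
  unfolding card_eq_sum sum.inter_filter[OF assms] by (simp add: of_bool_def)

lemma finite_edges: "finite (edges n)"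
proof -
  have "finite (UNIV :: color set)"
    by (rule finite_subset[of _ "{Red, Blue}"]) (use color.exhaust in auto)
  then show ?thesis unfolding edges_def by simp
qed

lemma finite_vertices: "finite (vertices n)"
  unfolding vertices_def by simp

lemma perfect_matching_finite: "perfect_matching n M \<Longrightarrow> finite M"
  unfolding perfect_matching_def using finite_edges finite_subset by blast

text \<open>Recolouring all edges at a vertex of \<open>X\<close> changes the colour of exactly one edge of each perfect
  matching, and the edges violated by \<open>X\<close> are those that become red when this is done at every
  vertex of \<open>X\<close>.\<close>

lemma viol_parity:
  assumes M: "perfect_matching n M" and X: "X \<subseteq> vertices n"
  shows "even (viol X M + reds M + card X)"
proof -
  have finM: "finite M" using M by (rule perfect_matching_finite)
  have finX: "finite X" using X finite_vertices finite_subset by blast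
  have "(\<Sum>e\<in>M. \<Sum>w\<in>X. of_bool (w \<in> ends e)) = (\<Sum>w\<in>X. \<Sum>e\<in>M. of_bool (w \<in> ends e) :: nat)"
    by (rule sum.swap)
  also have "\<dots> = (\<Sum>w\<in>X. 1)"
  proof (rule sum.cong[OF refl])
    fix w assume "w \<in> X"
    then obtain e where e: "e \<in> M" "w \<in> ends e" "\<And>e'. e' \<in> M \<Longrightarrow> w \<in> ends e' \<Longrightarrow> e' = e"
      using M X unfolding perfect_matching_def by blast
    then have "{e \<in> M. w \<in> ends e} = {e}" by blast
    then show "(\<Sum>e\<in>M. of_bool (w \<in> ends e) :: nat) = 1"
      by (simp add: sum_of_bool_eq_card[OF finM])
  qed
  finally have cX: "card X = (\<Sum>e\<in>M. \<Sum>w\<in>X. of_bool (w \<in> ends e))" by simp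
  have "viol X M = (\<Sum>e\<in>M. of_bool (violated X e))" "reds M = (\<Sum>e\<in>M. of_bool (edge_color e = Red))"
    unfolding viol_def reds_def by (simp_all only: sum_of_bool_eq_card[OF finM])
  then have "viol X M + reds M + card X =
      (\<Sum>e\<in>M. of_bool (violated X e) + of_bool (edge_color e = Red) + (\<Sum>w\<in>X. of_bool (w \<in> ends e)))"
    using cX by (simp add: sum.distrib)
  also have "even \<dots>"
  proof (rule dvd_sum)
    fix e :: edge
    obtain u v c where e: "e = (u, v, c)" by (cases e)
    have "(\<Sum>w\<in>X. of_bool (w \<in> ends e) :: nat) = card {w \<in> X. w \<in> ends e}"
      by (rule sum_of_bool_eq_card[OF finX])
    also have "{w \<in> X. w \<in> ends e} = X \<inter> {Inl u, Inr v}" by (auto simp: e)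
    also have "card \<dots> = of_bool (Inl u \<in> X) + of_bool (Inr v \<in> X)"
      by (cases "Inl u \<in> X"; cases "Inr v \<in> X") simp_all
    finally show "even (of_bool (violated X e) + of_bool (edge_color e = Red) + (\<Sum>w\<in>X. of_bool (w \<in> ends e) :: nat))"
      by (auto simp: e violated_def)
  qed
  finally show ?thesis .
qed

section \<open>Relabellings of the vertices\<close>

type_synonym relabelling = "(nat \<Rightarrow> nat) \<times> (nat \<Rightarrow> nat)"

definition act_vertices :: "relabelling \<Rightarrow> vertex set \<Rightarrow> vertex set" where
  "act_vertices g X = map_sum (fst g) (snd g) ` X"

definition act_edges :: "relabelling \<Rightarrow> edge set \<Rightarrow> edge set" where
  "act_edges g M = (\<lambda>(u, v, c). (fst g u, snd g v, c)) ` M"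

definition relabellings :: "nat \<Rightarrow> relabelling set" where
  "relabellings n = {p. p permutes {..<n}} \<times> {p. p permutes {..<n}}"

text \<open>\<open>s\<close> acts first. In a sum over all \<open>g\<close>, composing with
  \<open>s\<close> on this side therefore changes the underlying cut and matching by
  \<open>s\<close>.\<close>

definition relabel_comp :: "relabelling \<Rightarrow> relabelling \<Rightarrow> relabelling" where
  "relabel_comp g s = (fst g \<circ> fst s, snd g \<circ> snd s)"

lemma act_vertices_comp: "act_vertices (relabel_comp g s) X = act_vertices g (act_vertices s X)"
  unfolding act_vertices_def relabel_comp_def by (simp add: image_comp map_sum.comp)

lemma act_edges_comp: "act_edges (relabel_comp g s) M = act_edges g (act_edges s M)"
  unfolding act_edges_def relabel_comp_def by (simp add: image_comp) (intro image_cong refl, auto)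

lemma finite_relabellings: "finite (relabellings n)"
  unfolding relabellings_def by (simp add: finite_permutations)

lemma bij_betw_relabel_comp:
  assumes "s \<in> relabellings n"
  shows "bij_betw (\<lambda>g. relabel_comp g s) (relabellings n) (relabellings n)"
proof (rule bij_betw_byWitness[where f' = "\<lambda>g. relabel_comp g (inv (fst s), inv (snd s))"])
  have p: "fst s permutes {..<n}" "snd s permutes {..<n}" using assms unfolding relabellings_def by auto
  then have "fst s \<circ> inv (fst s) = id" "inv (fst s) \<circ> fst s = id"
    "snd s \<circ> inv (snd s) = id" "inv (snd s) \<circ> snd s = id"
    using permutes_inv_o by blast+
  then show "\<forall>g\<in>relabellings n. relabel_comp (relabel_comp g s) (inv (fst s), inv (snd s)) = g"
    "\<forall>g\<in>relabellings n. relabel_comp (relabel_comp g (inv (fst s), inv (snd s))) s = g"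
    by (auto simp: relabel_comp_def comp_assoc)
  show "(\<lambda>g. relabel_comp g s) ` relabellings n \<subseteq> relabellings n"
    using p unfolding relabellings_def relabel_comp_def by (auto intro: permutes_compose)
  show "(\<lambda>g. relabel_comp g (inv (fst s), inv (snd s))) ` relabellings n \<subseteq> relabellings n"
    using p unfolding relabellings_def relabel_comp_def by (auto intro!: permutes_compose permutes_inv)
qed

lemma viol_act:
  assumes "g \<in> relabellings n"
  shows "viol (act_vertices g X) (act_edges g M) = viol X M"
proof -
  have inj: "inj (fst g)" "inj (snd g)" using assms permutes_inj unfolding relabellings_def by auto
  have "{e \<in> act_edges g M. violated (act_vertices g X) e} = act_edges g {e \<in> M. violated X e}"
  proof -
    have "violated (act_vertices g X) (fst g u, snd g v, c) = violated X (u, v, c)" for u v c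
    proof -
      have "Inl (fst g u) \<in> act_vertices g X \<longleftrightarrow> Inl u \<in> X"
      proof -
        have "Inl (fst g u) = map_sum (fst g) (snd g) (Inl u)" by simp
        then show ?thesis unfolding act_vertices_def
          using inj_image_mem_iff[of "map_sum (fst g) (snd g)"] sum.inj_map[OF inj] by metis
      qed
      moreover have "Inr (snd g v) \<in> act_vertices g X \<longleftrightarrow> Inr v \<in> X"
      proof -
        have "Inr (snd g v) = map_sum (fst g) (snd g) (Inr v)" by simp
        then show ?thesis unfolding act_vertices_def
          using inj_image_mem_iff[of "map_sum (fst g) (snd g)"] sum.inj_map[OF inj] by metis
      qed
      ultimately show ?thesis by (simp add: violated_def)
    qed
    then have "violated (act_vertices g X) (case e of (u, v, c) \<Rightarrow> (fst g u, snd g v, c)) = violated X e" for e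
      by (cases e) simp
    then show ?thesis unfolding act_edges_def by (simp only: Compr_image_eq)
  qed
  moreover have "inj_on (\<lambda>(u, v, c). (fst g u, snd g v, c)) A" for A :: "edge set"
    using inj by (auto simp: inj_on_def)
  ultimately show ?thesis unfolding viol_def by (simp add: act_edges_def card_image)
qed

lemma perfect_matching_permutation:
  assumes "p permutes {..<n}"
  shows "perfect_matching n ((\<lambda>l. (l, p l, c l)) ` {..<n})"
proof -
  let ?M = "(\<lambda>l. (l, p l, c l)) ` {..<n}"
  have sub: "?M \<subseteq> edges n" using permutes_in_image[OF assms] by (auto simp: edges_def)
  have uniq: "\<exists>!e. e \<in> ?M \<and> w \<in> ends e" if "w \<in> vertices n" for w
  proof (cases w)
    case (Inl l)
    then have "l < n" using that by (auto simp: vertices_def)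
    then show ?thesis using Inl by (intro ex1I[of _ "(l, p l, c l)"]) auto
  next
    case (Inr l)
    then have "l < n" using that by (auto simp: vertices_def)
    then obtain k where k: "k < n" "p k = l" using permutes_image[OF assms] by (metis imageE lessThan_iff)
    show ?thesis
    proof (rule ex1I)
      show "(k, p k, c k) \<in> ?M \<and> w \<in> ends (k, p k, c k)" using Inr k by (auto simp: image_iff)
      fix e assume "e \<in> ?M \<and> w \<in> ends e"
      then obtain k' where "e = (k', p k', c k')" "p k' = p k" using Inr k by auto
      then show "e = (k, p k, c k)" using permutes_inj[OF assms] by (metis injD)
    qed
  qed
  show ?thesis unfolding perfect_matching_def by (intro conjI ballI sub uniq)
qed

text \<open>The graph of \<open>p\<close> is carried to the graph of
  \<open>snd g \<circ> p \<circ> inv (fst g)\<close>.\<close>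

lemma perfect_matching_act:
  assumes "p permutes {..<n}" "g \<in> relabellings n"
  shows "perfect_matching n (act_edges g ((\<lambda>l. (l, p l, c l)) ` {..<n}))"
proof -
  have g: "fst g permutes {..<n}" "snd g permutes {..<n}" using assms(2) unfolding relabellings_def by auto
  have "act_edges g ((\<lambda>l. (l, p l, c l)) ` {..<n}) = (\<lambda>l. (fst g l, snd g (p l), c l)) ` {..<n}"
    unfolding act_edges_def by (simp add: image_comp o_def)
  also have "\<dots> = (\<lambda>l. (l, (snd g \<circ> p \<circ> inv (fst g)) l, (c \<circ> inv (fst g)) l)) ` fst g ` {..<n}"
    using permutes_inverses[OF g(1)] by (simp add: image_comp o_def)
  also have "fst g ` {..<n} = {..<n}" by (rule permutes_image[OF g(1)])
  finally show ?thesis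
    using perfect_matching_permutation[of "snd g \<circ> p \<circ> inv (fst g)" n "c \<circ> inv (fst g)"]
      permutes_compose[OF permutes_compose[OF permutes_inv[OF g(1)] assms(1)] g(2)]
    by (simp add: comp_assoc)
qed

lemma act_vertices_subset:
  assumes "g \<in> relabellings n" "X \<subseteq> vertices n"
  shows "act_vertices g X \<subseteq> vertices n"
proof
  have g: "fst g permutes {..<n}" "snd g permutes {..<n}" using assms(1) unfolding relabellings_def by auto
  fix w assume "w \<in> act_vertices g X"
  then obtain x where x: "w = map_sum (fst g) (snd g) x" "x \<in> X"
    unfolding act_vertices_def by (rule imageE)
  have xv: "x \<in> vertices n" using assms(2) x(2) by (rule subsetD)
  show "w \<in> vertices n"
  proof (cases x)
    case (Inl i)
    then have "fst g i < n" using xv permutes_in_image[OF g(1), of i] by (simp add: vertices_def Plus_def image_iff)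
    then show ?thesis using Inl x(1) by (simp add: vertices_def InlI)
  next
    case (Inr i)
    then have "snd g i < n" using xv permutes_in_image[OF g(2), of i] by (simp add: vertices_def Plus_def image_iff)
    then show ?thesis using Inr x(1) by (simp add: vertices_def InrI)
  qed
qed

lemma card_act_vertices:
  assumes "g \<in> relabellings n"
  shows "card (act_vertices g X) = card X"
proof -
  have "inj (fst g)" "inj (snd g)" using assms permutes_inj unfolding relabellings_def by auto
  then show ?thesis unfolding act_vertices_def by (intro card_image) (meson inj_on_subset subset_UNIV sum.inj_map)
qed

text \<open>An injective self-map of a finite set is onto, so an inclusion is enough for
  invariance.\<close>

lemma act_vertices_fixedI:
  assumes "g \<in> relabellings n" "finite X" "act_vertices g X \<subseteq> X"
  shows "act_vertices g X = X"
proof -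
  have "inj (fst g)" "inj (snd g)" using assms permutes_inj unfolding relabellings_def by auto
  then have "inj_on (map_sum (fst g) (snd g)) X" by (meson inj_on_subset subset_UNIV sum.inj_map)
  then show ?thesis using endo_inj_surj assms unfolding act_vertices_def by blast
qed

lemma act_edges_fixedI:
  assumes "g \<in> relabellings n" "finite M" "act_edges g M \<subseteq> M"
  shows "act_edges g M = M"
proof -
  have "inj (fst g)" "inj (snd g)" using assms permutes_inj unfolding relabellings_def by auto
  then have "inj_on (\<lambda>(u, v, c). (fst g u, snd g v, c)) M" by (auto simp: inj_on_def)
  then show ?thesis using endo_inj_surj assms unfolding act_edges_def by blast
qed

subsection \<open>The family of cuts and matchings\<close>

text \<open>
  The labels \<open>0, ..., 4\<close> carry the five special edges.  A cut has one two-state gadget for each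
  \<open>i < N\<close>, whose state is whether \<open>i \<in> a\<close>: the pair \<open>pu i\<close>, \<open>pv i\<close> lies inside or outside the cut.
  A matching also has one gadget for each \<open>i < N\<close>: the labels \<open>3 * i + 3\<close> and \<open>3 * i + 4\<close> are matched
  crosswise in blue or straight in red.  The gadgets \<open>i \<ge> 1\<close> never produce violated edges.  For
  \<open>i = 0\<close> both gadgets use the special labels \<open>3\<close> and \<open>4\<close>, and there are five violated edges iff
  \<open>0 \<notin> a\<close> and \<open>0 \<notin> b\<close>, otherwise three.  When \<open>0 \<in> b\<close>, the matching does not see which of the
  cut gadgets is the special one, and vice versa.
\<close>

definition pu :: "nat \<Rightarrow> nat" where "pu i = (if i = 0 then 3 else 3 * i + 2)"
definition pv :: "nat \<Rightarrow> nat" where "pv i = (if i = 0 then 4 else 3 * i + 2)"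

text \<open>The second union is the same for all \<open>a\<close>. It keeps both states of the
  matching gadgets \<open>i \<ge> 1\<close> free of violations, and for \<open>0 \<in> a\<close> the
  pair \<open>Inl 3\<close>, \<open>Inr 4\<close> continues its pattern to
  \<open>i = 0\<close>.\<close>

definition cutset :: "nat \<Rightarrow> nat set \<Rightarrow> vertex set" where
  "cutset N a = (\<Union>i\<in>a. {Inl (pu i), Inr (pv i)}) \<union> (\<Union>i\<in>{1..<N}. {Inl (3 * i + 3), Inr (3 * i + 4)})"

definition block :: "nat set \<Rightarrow> nat \<Rightarrow> edge set" where
  "block b i = (if i \<in> b then {(3 * i + 3, 3 * i + 4, Blue), (3 * i + 4, 3 * i + 3, Blue)}
    else {(3 * i + 3, 3 * i + 3, Red), (3 * i + 4, 3 * i + 4, Red)})"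

definition core :: "edge set" where
  "core = {(0, 0, Red), (1, 1, Red), (2, 2, Red)}"

text \<open>The edges at the labels \<open>3 * i + 2\<close> join \<open>pu i\<close> to
  \<open>pv i\<close> for the cut gadgets \<open>i \<ge> 1\<close>; those from
  \<open>3 * N + 2\<close> on fill up the matching for larger \<open>n\<close>.\<close>

definition loose :: "nat \<Rightarrow> nat \<Rightarrow> edge set" where
  "loose n N = (\<lambda>l. (l, l, Blue)) ` ((\<lambda>i. 3 * i + 2) ` {1..<N} \<union> {3 * N + 2..<n})"

definition matching :: "nat \<Rightarrow> nat \<Rightarrow> nat set \<Rightarrow> edge set" where
  "matching n N b = core \<union> (\<Union>i<N. block b i) \<union> loose n N"

definition swapA :: "nat \<Rightarrow> relabelling" where
  "swapA i = (Transposition.transpose 3 (pu i), Transposition.transpose 4 (pv i))"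

definition swapB :: "nat \<Rightarrow> relabelling" where
  "swapB i = (let s = Transposition.transpose 3 (3 * i + 3) \<circ> Transposition.transpose 4 (3 * i + 4) in (s, s))"

definition rot5 :: "nat \<Rightarrow> nat" where
  "rot5 l = (if l < 4 then l + 1 else if l = 4 then 0 else l)"

definition rot :: relabelling where "rot = (rot5, rot5)"

section \<open>Action of the swaps and the rotation\<close>

lemma rot5_simps [simp]:
  "rot5 0 = 1" "rot5 (Suc 0) = 2" "rot5 2 = 3" "rot5 3 = 4" "rot5 4 = 0"
  by (simp_all add: rot5_def)

lemma rot5_permutes:
  assumes "n \<ge> 5"
  shows "rot5 permutes {..<n}"
proof (rule bij_imp_permutes)
  show "bij_betw rot5 {..<n} {..<n}"
    by (rule bij_betw_byWitness[where f' = "\<lambda>l. if l = 0 then 4 else if l \<le> 4 then l - 1 else l"])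
      (use assms in \<open>auto simp: rot5_def\<close>)
  show "rot5 l = l" if "l \<notin> {..<n}" for l using that assms by (auto simp: rot5_def)
qed

lemma rot_relabelling: "n \<ge> 5 \<Longrightarrow> rot \<in> relabellings n"
  unfolding rot_def relabellings_def using rot5_permutes by simp

lemma swapA_relabelling: "i < N \<Longrightarrow> 3 * N + 2 \<le> n \<Longrightarrow> swapA i \<in> relabellings n"
  unfolding swapA_def relabellings_def by (auto simp: pu_def pv_def intro!: permutes_swap_id)

lemma swapB_relabelling: "i < N \<Longrightarrow> 3 * N + 2 \<le> n \<Longrightarrow> swapB i \<in> relabellings n"
  unfolding swapB_def relabellings_def Let_def by (auto intro!: permutes_swap_id permutes_compose)

lemma rot_pow5: "relabel_comp (relabel_comp (relabel_comp (relabel_comp (relabel_comp g rot) rot) rot) rot) rot = g"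
proof -
  have "rot5 \<circ> rot5 \<circ> rot5 \<circ> rot5 \<circ> rot5 = id" by (rule ext) (simp add: rot5_def)
  then have "fst g \<circ> (rot5 \<circ> rot5 \<circ> rot5 \<circ> rot5 \<circ> rot5) = fst g" "snd g \<circ> (rot5 \<circ> rot5 \<circ> rot5 \<circ> rot5 \<circ> rot5) = snd g"
    by simp_all
  then show ?thesis unfolding relabel_comp_def rot_def by (simp add: comp_assoc)
qed

lemma transpose_pu: "Transposition.transpose 3 (pu i) (pu j) = pu (Transposition.transpose 0 i j)"
  by (auto simp: Transposition.transpose_def pu_def)

lemma transpose_pv: "Transposition.transpose 4 (pv i) (pv j) = pv (Transposition.transpose 0 i j)"
  by (auto simp: Transposition.transpose_def pv_def)

lemma act_vertices_Un: "act_vertices g (X \<union> Y) = act_vertices g X \<union> act_vertices g Y"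
  unfolding act_vertices_def by (rule image_Un)

lemma act_vertices_UN: "act_vertices g (\<Union>i\<in>I. F i) = (\<Union>i\<in>I. act_vertices g (F i))"
  unfolding act_vertices_def by (rule image_UN)

lemma act_edges_Un: "act_edges g (X \<union> Y) = act_edges g X \<union> act_edges g Y"
  unfolding act_edges_def by (rule image_Un)

lemma act_edges_UN: "act_edges g (\<Union>i\<in>I. F i) = (\<Union>i\<in>I. act_edges g (F i))"
  unfolding act_edges_def by (rule image_UN)

lemma swapA_cutset: "act_vertices (swapA i) (cutset N a) = cutset N (Transposition.transpose 0 i ` a)"
proof -
  have 1: "act_vertices (swapA i) {Inl (pu j), Inr (pv j)} =
      {Inl (pu (Transposition.transpose 0 i j)), Inr (pv (Transposition.transpose 0 i j))}" for j
    unfolding act_vertices_def swapA_def by (simp add: transpose_pu transpose_pv)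
  have 2: "act_vertices (swapA i) {Inl (3 * j + 3), Inr (3 * j + 4)} = {Inl (3 * j + 3), Inr (3 * j + 4)}"
    if "j \<in> {1..<N}" for j
  proof -
    have "3 * j + 3 \<noteq> 3" "3 * j + 3 \<noteq> pu i" "3 * j + 4 \<noteq> 4" "3 * j + 4 \<noteq> pv i"
      using that unfolding pu_def pv_def by (auto, presburger+)
    then have "Transposition.transpose 3 (pu i) (3 * j + 3) = 3 * j + 3"
      "Transposition.transpose 4 (pv i) (3 * j + 4) = 3 * j + 4"
      by (simp_all only: transpose_apply_other not_False_eq_True)
    then show ?thesis
      unfolding act_vertices_def swapA_def
      by (simp only: image_insert image_empty map_sum.simps fst_conv snd_conv)
  qed
  show ?thesis
    unfolding cutset_def act_vertices_Un act_vertices_UN 1 using 2 by simp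
qed

lemma mem_cutset:
  "Inl l \<in> cutset N a \<longleftrightarrow> (\<exists>j\<in>a. pu j = l) \<or> (\<exists>j\<in>{1..<N}. 3 * j + 3 = l)"
  "Inr l \<in> cutset N a \<longleftrightarrow> (\<exists>j\<in>a. pv j = l) \<or> (\<exists>j\<in>{1..<N}. 3 * j + 4 = l)"
  unfolding cutset_def by auto

lemma finite_cutset: "finite a \<Longrightarrow> finite (cutset N a)"
  unfolding cutset_def by simp

lemma finite_matching: "finite (matching n N b)"
  unfolding matching_def core_def block_def loose_def by simp

text \<open>For \<open>0 \<in> b\<close> the edge \<open>(3, 4, Blue)\<close> joins
  \<open>pu 0\<close> to \<open>pv 0\<close> just as a loose blue edge joins \<open>pu i\<close> to
  \<open>pv i\<close>. The swap exchanges these two edges and moves no other.\<close>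

lemma swapA_matching:
  assumes "i < N" "3 * N + 2 \<le> n" "0 \<in> b"
  shows "act_edges (swapA i) (matching n N b) = matching n N b"
proof (rule act_edges_fixedI[OF swapA_relabelling[OF assms(1,2)] finite_matching])
  show "act_edges (swapA i) (matching n N b) \<subseteq> matching n N b"
  proof (cases "i = 0")
    case True
    then show ?thesis by (auto simp: act_edges_def swapA_def pu_def pv_def)
  next
    case False
    let ?s = "\<lambda>(u, v, c :: color). (fst (swapA i) u, snd (swapA i) v, c)"
    have s: "fst (swapA i) u = (if u = 3 then 3 * i + 2 else if u = 3 * i + 2 then 3 else u)"
      "snd (swapA i) v = (if v = 4 then 3 * i + 2 else if v = 3 * i + 2 then 4 else v)" for u v
      using False by (simp_all add: swapA_def pu_def pv_def Transposition.transpose_def)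
    have l: "(3 * i + 2, 3 * i + 2, Blue) \<in> loose n N" using assms False by (auto simp: loose_def)
    have "?s e \<in> matching n N b" if "e \<in> core" for e
    proof -
      have "?s e = e" using that False by (auto simp: core_def s)
      then show ?thesis using that by (simp add: matching_def)
    qed
    moreover have "?s e \<in> matching n N b" if e: "e \<in> block b j" and j: "j < N" for e j
    proof (cases "j = 0")
      case True
      then have "e = (3, 4, Blue) \<or> e = (4, 3, Blue)" using e assms(3) by (auto simp: block_def)
      then have "?s e = (3 * i + 2, 3 * i + 2, Blue) \<or> ?s e = (4, 3, Blue)"
        using False by (auto simp: s)
      moreover have "(4, 3, Blue) \<in> block b 0" using assms(3) by (simp add: block_def)
      ultimately show ?thesis using l assms(1) unfolding matching_def by fastforce
    next
      case j0: False
      have "?s e = e" using e j0 by (auto simp: block_def s split: if_splits) presburger+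
      then show ?thesis using e j by (auto simp: matching_def)
    qed
    moreover have "?s e \<in> matching n N b" if e: "e \<in> loose n N" for e
    proof -
      obtain l where l: "e = (l, l, Blue)" "(\<exists>j\<in>{1..<N}. l = 3 * j + 2) \<or> 3 * N + 2 \<le> l"
        using e by (auto simp: loose_def)
      have "l \<noteq> 3" "l \<noteq> 4" using l(2) assms(1) False by (auto, presburger+)
      then have "?s e = (3, 4, Blue) \<or> ?s e = e" using l(1) by (simp add: s)
      moreover have "(3, 4, Blue) \<in> block b 0" using assms(3) by (simp add: block_def)
      ultimately show ?thesis using e assms(1) unfolding matching_def by fastforce
    qed
    ultimately have "?s e \<in> matching n N b" if "e \<in> matching n N b" for e
      using that unfolding matching_def by blast
    then show ?thesis unfolding act_edges_def by blast
  qed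
qed

lemma swapB_simps:
  "fst (swapB i) (3 * j + 3) = 3 * Transposition.transpose 0 i j + 3"
  "snd (swapB i) (3 * j + 3) = 3 * Transposition.transpose 0 i j + 3"
  "fst (swapB i) (3 * j + 4) = 3 * Transposition.transpose 0 i j + 4"
  "snd (swapB i) (3 * j + 4) = 3 * Transposition.transpose 0 i j + 4"
proof -
  have "fst (swapB i) (3 * j + 3) = 3 * Transposition.transpose 0 i j + 3"
    unfolding swapB_def Let_def by (auto simp: Transposition.transpose_def) presburger+
  moreover have "fst (swapB i) (3 * j + 4) = 3 * Transposition.transpose 0 i j + 4"
    unfolding swapB_def Let_def by (auto simp: Transposition.transpose_def)
  moreover have "snd (swapB i) = fst (swapB i)" unfolding swapB_def Let_def by simp
  ultimately show "fst (swapB i) (3 * j + 3) = 3 * Transposition.transpose 0 i j + 3"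
    "snd (swapB i) (3 * j + 3) = 3 * Transposition.transpose 0 i j + 3"
    "fst (swapB i) (3 * j + 4) = 3 * Transposition.transpose 0 i j + 4"
    "snd (swapB i) (3 * j + 4) = 3 * Transposition.transpose 0 i j + 4" by simp_all
qed

lemma swapB_other:
  assumes "l \<notin> {3, 4, 3 * i + 3, 3 * i + 4}"
  shows "fst (swapB i) l = l" "snd (swapB i) l = l"
  using assms unfolding swapB_def Let_def by (auto simp: Transposition.transpose_def)

lemma swapB_matching:
  assumes "i < N" "3 * N + 2 \<le> n"
  shows "act_edges (swapB i) (matching n N b) = matching n N (Transposition.transpose 0 i ` b)"
proof -
  have c: "act_edges (swapB i) core = core"
  proof -
    have "fst (swapB i) l = l" "snd (swapB i) l = l" if "l < 3" for l
      using that by (intro swapB_other, auto)+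
    then show ?thesis unfolding act_edges_def core_def by simp
  qed
  have b: "act_edges (swapB i) (block b j) = block (Transposition.transpose 0 i ` b) (Transposition.transpose 0 i j)" for j
    unfolding act_edges_def block_def by (simp add: swapB_simps in_transpose_image_iff)
  have "act_edges (swapB i) (\<Union>j<N. block b j) =
      (\<Union>j\<in>Transposition.transpose 0 i ` {..<N}. block (Transposition.transpose 0 i ` b) j)"
    unfolding act_edges_UN b by simp
  also have "Transposition.transpose 0 i ` {..<N} = {..<N}"
    using assms(1) by (intro permutes_image permutes_swap_id) auto
  finally have bs: "act_edges (swapB i) (\<Union>j<N. block b j) = (\<Union>j<N. block (Transposition.transpose 0 i ` b) j)" .
  have l: "act_edges (swapB i) (loose n N) = loose n N"
  proof -
    have "fst (swapB i) l = l \<and> snd (swapB i) l = l" if "l \<in> (\<lambda>i. 3 * i + 2) ` {1..<N} \<union> {3 * N + 2..<n}" for l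
    proof -
      have "l \<notin> {3, 4, 3 * i + 3, 3 * i + 4}" using that assms(1) by (auto, presburger+)
      then show ?thesis using swapB_other by blast
    qed
    then show ?thesis unfolding act_edges_def loose_def image_image by (intro image_cong) auto
  qed
  show ?thesis unfolding matching_def act_edges_Un c bs l ..
qed

text \<open>For \<open>0 \<in> a\<close> the cut contains \<open>Inl (3 * j + 3)\<close> and
  \<open>Inr (3 * j + 4)\<close> for all \<open>j < N\<close>, including 0. The swap permutes these
  and fixes the vertices with labels \<open>3 * j + 2\<close>, \<open>j \<ge> 1\<close>.\<close>

lemma swapB_cutset:
  assumes "i < N" "3 * N + 2 \<le> n" "0 \<in> a" "finite a"
  shows "act_vertices (swapB i) (cutset N a) = cutset N a"
proof (rule act_vertices_fixedI[OF swapB_relabelling[OF assms(1,2)] finite_cutset[OF assms(4)]])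
  have mem: "Inl (3 * j + 3) \<in> cutset N a" "Inr (3 * j + 4) \<in> cutset N a" if "j < N" for j
    using that assms(3) by (cases "j = 0"; force simp: cutset_def pu_def pv_def)+
  show "act_vertices (swapB i) (cutset N a) \<subseteq> cutset N a"
  proof
    fix w assume "w \<in> act_vertices (swapB i) (cutset N a)"
    then obtain x where x: "x \<in> cutset N a" "w = map_sum (fst (swapB i)) (snd (swapB i)) x"
      unfolding act_vertices_def by blast
    have tN: "Transposition.transpose 0 i j < N" if "j < N" for j
      using that assms(1) by (auto simp: Transposition.transpose_def)
    consider j where "j < N" "x = Inl (3 * j + 3)" | j where "j < N" "x = Inr (3 * j + 4)"
      | j where "j \<in> a" "j \<noteq> 0" "x = Inl (3 * j + 2) \<or> x = Inr (3 * j + 2)"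
      using x(1) assms(1) unfolding cutset_def pu_def pv_def by (auto split: if_splits) (force | presburger)+
    then show "w \<in> cutset N a"
    proof cases
      case 1
      then show ?thesis using x(2) mem(1)[OF tN[of j]] by (simp add: swapB_simps)
    next
      case 2
      then show ?thesis using x(2) mem(2)[OF tN[of j]] by (simp add: swapB_simps)
    next
      case 3
      have "3 * j + 2 \<notin> {3, 4, 3 * i + 3, 3 * i + 4}" using 3(2) by (auto, presburger+)
      then have "w = x" using 3(3) x(2) swapB_other[of "3 * j + 2" i] by auto
      then show ?thesis using x(1) by simp
    qed
  qed
qed

text \<open>Without the pair of gadget 0 the cut avoids the labels 0 to 4.\<close>

lemma rot_cutset:
  assumes "0 \<notin> a"
  shows "act_vertices rot (cutset N a) = cutset N a"
proof -
  have "map_sum (fst rot) (snd rot) x = x" if "x \<in> cutset N a" for x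
    using that assms unfolding cutset_def rot_def by (auto simp: pu_def pv_def rot5_def split: if_splits) (metis gr0I | presburger)+
  then show ?thesis unfolding act_vertices_def by simp
qed

definition outer :: "nat \<Rightarrow> nat \<Rightarrow> nat set \<Rightarrow> edge set" where
  "outer n N b = (\<Union>i\<in>{1..<N}. block b i) \<union> loose n N"

lemma matching_outer:
  assumes "N > 0"
  shows "matching n N b = core \<union> block b 0 \<union> outer n N b"
proof -
  have "{..<N} = insert 0 {1..<N}" using assms by auto
  then show ?thesis unfolding matching_def outer_def by auto
qed

lemma outer_ge5:
  assumes "(u, v, c) \<in> outer n N b" "N > 0"
  shows "u \<ge> 5" "v \<ge> 5"
  using assms unfolding outer_def block_def loose_def by (auto split: if_splits)

lemma rot_outer:
  assumes "N > 0"
  shows "act_edges rot (outer n N b) = outer n N b"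
proof -
  have fixed: "(\<lambda>(u, v, c). (fst rot u, snd rot v, c)) e = e" if e: "e \<in> outer n N b" for e
  proof -
    obtain u v c where uvc: "e = (u, v, c)" by (cases e)
    then have "u \<ge> 5" "v \<ge> 5" using outer_ge5 e assms by blast+
    then show ?thesis by (simp add: uvc rot_def rot5_def)
  qed
  show ?thesis unfolding act_edges_def using fixed by simp
qed

text \<open>For \<open>0 \<notin> b\<close> the special edges are the five straight red ones at the
  labels 0 to 4, which the rotation permutes.\<close>

lemma rot_matching:
  assumes "0 \<notin> b" "N > 0"
  shows "act_edges rot (matching n N b) = matching n N b"
proof -
  have "act_edges rot (core \<union> block b 0) = core \<union> block b 0"
    using assms(1) by (simp add: act_edges_def core_def block_def rot_def insert_commute)
  then show ?thesis
    unfolding matching_outer[OF assms(2)] act_edges_Un[of _ "core \<union> block b 0"] by (simp add: rot_outer assms)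
qed

text \<open>Of the vertices of a matching gadget \<open>i \<ge> 1\<close>, the cut contains exactly
  \<open>Inl (3 * i + 3)\<close> and \<open>Inr (3 * i + 4)\<close>: a crosswise blue edge has both
  or no ends in the cut, a straight red edge has exactly one. A cut gadget \<open>i \<ge> 1\<close>
  takes in or leaves out both ends of a loose blue edge.\<close>

lemma outer_not_violated:
  assumes "e \<in> outer n N b" "a \<subseteq> {..<N}"
  shows "\<not> violated (cutset N a) e"
proof -
  have A: "Inl (3 * i + 3) \<in> cutset N a" "Inr (3 * i + 4) \<in> cutset N a"
    "Inr (3 * i + 3) \<notin> cutset N a" "Inl (3 * i + 4) \<notin> cutset N a" if "i \<in> {1..<N}" for i
  proof -
    have "pv j \<noteq> 3 * i + 3" "3 * j + 4 \<noteq> 3 * i + 3" "pu j \<noteq> 3 * i + 4" "3 * j + 3 \<noteq> 3 * i + 4" for j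
      unfolding pu_def pv_def by presburger+
    then show "Inl (3 * i + 3) \<in> cutset N a" "Inr (3 * i + 4) \<in> cutset N a"
      "Inr (3 * i + 3) \<notin> cutset N a" "Inl (3 * i + 4) \<notin> cutset N a"
      using that unfolding mem_cutset by metis+
  qed
  have B: "Inl (3 * i + 2) \<in> cutset N a \<longleftrightarrow> Inr (3 * i + 2) \<in> cutset N a" if "i \<in> {1..<N}" for i
  proof -
    have "i \<noteq> 0" using that by simp
    then have "(pu j = 3 * i + 2) = (j = i)" "(pv j = 3 * i + 2) = (j = i)"
      "3 * j + 3 \<noteq> 3 * i + 2" "3 * j + 4 \<noteq> 3 * i + 2" for j
      unfolding pu_def pv_def by presburger+
    then show ?thesis unfolding mem_cutset by metis
  qed
  have C: "Inl l \<notin> cutset N a" "Inr l \<notin> cutset N a" if "l \<ge> 3 * N + 2" "N > 0" for l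
    using that assms(2) unfolding cutset_def pu_def pv_def by (auto split: if_splits) 
  consider i where "i \<in> {1..<N}" "e \<in> block b i" | i where "i \<in> {1..<N}" "e = (3 * i + 2, 3 * i + 2, Blue)"
    | l where "l \<ge> 3 * N + 2" "e = (l, l, Blue)"
    using assms(1) unfolding outer_def loose_def by auto
  then show ?thesis
  proof cases
    case 1
    then show ?thesis using A[OF 1(1)] by (auto simp: block_def violated_def split: if_splits)
  next
    case 2
    then show ?thesis using B[OF 2(1)] by (simp add: violated_def)
  next
    case 3
    show ?thesis
    proof (cases "N > 0")
      case True
      then show ?thesis using C[OF 3(1)] 3(2) by (simp add: violated_def)
    next
      case False
      then show ?thesis using assms(2) 3(2) by (simp add: violated_def cutset_def)
    qed
  qed
qed

section \<open>Counts of violated edges\<close>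

lemma cutset_small:
  "Inl 0 \<notin> cutset N a" "Inl (Suc 0) \<notin> cutset N a" "Inl 2 \<notin> cutset N a" "Inl 3 \<in> cutset N a \<longleftrightarrow> 0 \<in> a" "Inl 4 \<notin> cutset N a"
  "Inr 0 \<notin> cutset N a" "Inr (Suc 0) \<notin> cutset N a" "Inr 2 \<notin> cutset N a" "Inr 3 \<notin> cutset N a" "Inr 4 \<in> cutset N a \<longleftrightarrow> 0 \<in> a"
  unfolding cutset_def pu_def pv_def by (auto split: if_splits)

lemma viol_cutset:
  assumes "N > 0" "a \<subseteq> {..<N}" "M = S \<union> outer n N b"
  shows "viol (cutset N a) M = card {e \<in> S. violated (cutset N a) e}"
proof -
  have "{e \<in> M. violated (cutset N a) e} = {e \<in> S. violated (cutset N a) e}"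
    using outer_not_violated[OF _ assms(2)] assms(3) by blast
  then show ?thesis unfolding viol_def by simp
qed

lemma viol_three:
  assumes "N > 0" "a \<subseteq> {..<N}" "0 \<in> a" "0 \<in> b"
  shows "viol (cutset N a) (matching n N b) = 3"
proof -
  have "{e \<in> core \<union> block b 0. violated (cutset N a) e} = {(0, 0, Red), (1, 1, Red), (2, 2, Red)}"
    using assms by (auto simp: core_def block_def violated_def cutset_small)
  then show ?thesis using viol_cutset[OF assms(1,2) matching_outer[OF assms(1)]] by simp
qed

lemma viol_five:
  assumes "N > 0" "a \<subseteq> {..<N}" "0 \<notin> a" "0 \<notin> b"
  shows "viol (cutset N a) (matching n N b) = 5"
proof -
  have "{e \<in> core \<union> block b 0. violated (cutset N a) e} =
      {(0, 0, Red), (1, 1, Red), (2, 2, Red), (3, 3, Red), (4, 4, Red)}"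
    using assms by (auto simp: core_def block_def violated_def cutset_small)
  then show ?thesis using viol_cutset[OF assms(1,2) matching_outer[OF assms(1)]] by simp
qed

text \<open>Among the straight red edges at special labels, the cut violates those at 0, 1, 2. After
  two rotations the matching has its red special edges at 2, 3, 4, and its blue ones join 0 and 1,
  away from the cut. Only label 2 remains.\<close>

lemma viol_conflict:
  assumes "N > 0" "a \<subseteq> {..<N}" "0 \<in> a" "0 \<in> b"
  shows "viol (cutset N a) (act_edges rot (act_edges rot (matching n N b))) = 1"
proof -
  let ?S = "act_edges rot (act_edges rot (core \<union> block b 0))"
  have S: "?S = {(2, 2, Red), (3, 3, Red), (4, 4, Red), (0, 1, Blue), (1, 0, Blue)}"
    using assms(4) by (auto simp: core_def block_def act_edges_def rot_def)
  have "{e \<in> ?S. violated (cutset N a) e} = {(2, 2, Red)}"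
    unfolding S using assms(3) by (auto simp: violated_def cutset_small)
  moreover have "act_edges rot (act_edges rot (matching n N b)) = ?S \<union> outer n N b"
    unfolding matching_outer[OF assms(1)] act_edges_Un[of _ "core \<union> block b 0"]
    by (simp add: rot_outer assms act_edges_Un)
  ultimately show ?thesis using viol_cutset[OF assms(1,2)] by simp
qed

lemma even_card_cutset:
  assumes "a \<subseteq> {..<N}"
  shows "even (card (cutset N a))"
proof -
  let ?A = "pu ` a \<union> (\<lambda>i. 3 * i + 3) ` {1..<N}" and ?B = "pv ` a \<union> (\<lambda>i. 3 * i + 4) ` {1..<N}"
  have fin: "finite a" using assms finite_subset by blast
  have "cutset N a = Inl ` ?A \<union> Inr ` ?B" unfolding cutset_def by auto
  moreover have "card (Inl ` ?A \<union> Inr ` ?B :: vertex set) = card ?A + card ?B"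
    using fin by (subst card_Un_disjoint) (auto simp: card_image)
  moreover have "card ?A = card a + card {1..<N}"
  proof -
    have "inj_on pu a" by (auto simp: inj_on_def pu_def split: if_splits)
    moreover have "pu ` a \<inter> (\<lambda>i. 3 * i + 3) ` {1..<N} = {}" by (auto simp: pu_def split: if_splits) presburger+
    ultimately show ?thesis using fin by (simp add: card_Un_disjoint card_image inj_on_def)
  qed
  moreover have "card ?B = card a + card {1..<N}"
  proof -
    have "inj_on pv a" by (auto simp: inj_on_def pv_def split: if_splits)
    moreover have "pv ` a \<inter> (\<lambda>i. 3 * i + 4) ` {1..<N} = {}" by (auto simp: pv_def split: if_splits) presburger+
    ultimately show ?thesis using fin by (simp add: card_Un_disjoint card_image inj_on_def)
  qed
  ultimately show ?thesis by simp
qed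

lemma cutset_subset:
  assumes "a \<subseteq> {..<N}" "3 * N + 2 \<le> n"
  shows "cutset N a \<subseteq> vertices n"
proof -
  have "pu i < n" "pv i < n" if "i \<in> a" for i
    using that assms by (auto simp: pu_def pv_def)
  moreover have "3 * i + 3 < n" "3 * i + 4 < n" if "i \<in> {1..<N}" for i
    using that assms by auto
  ultimately show ?thesis unfolding cutset_def vertices_def
    by (intro Un_least UN_least insert_subsetI empty_subsetI InlI InrI) auto
qed

section \<open>The constructed matchings are perfect\<close>

lemma label_cases:
  fixes l N :: nat
  obtains "l < 3" | i where "i < N" "l = 3 * i + 3" | i where "i < N" "l = 3 * i + 4"
    | i where "i \<in> {1..<N}" "l = 3 * i + 2" | "3 * N + 2 \<le> l"
proof -
  consider "l < 3" | "3 * N + 2 \<le> l" | "3 \<le> l" "l < 3 * N + 2" by linarith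
  then show ?thesis
  proof cases
    case 3
    define q where "q = l div 3"
    have q: "q \<ge> 1" using 3 unfolding q_def by simp
    have "l = 3 * q \<or> l = 3 * q + 1 \<or> l = 3 * q + 2" unfolding q_def by presburger
    then consider "l = 3 * q" | "l = 3 * q + 1" | "l = 3 * q + 2" by blast
    then show ?thesis
    proof cases
      case 1
      then show ?thesis using that(2)[of "q - 1"] q 3(2) by auto
    next
      case 2
      then show ?thesis using that(3)[of "q - 1"] q 3(2) by auto
    next
      case c: 3
      then show ?thesis using that(4)[of q] q 3(2) by auto
    qed
  qed (use that in auto)
qed

text \<open>The permutation is the involution exchanging \<open>3 * i + 3\<close> and
  \<open>3 * i + 4\<close> for \<open>i \<in> b\<close>. As the graph of a permutation, the matching
  is recognized as perfect and stays so under relabellings by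
  \<open>perfect_matching_act\<close>.\<close>

lemma matching_graph:
  assumes "N > 0" "3 * N + 2 \<le> n" "b \<subseteq> {..<N}"
  obtains p c where "p permutes {..<n}" "matching n N b = (\<lambda>l. (l, p l, c l)) ` {..<n}"
proof -
  define p where "p l = (if \<exists>i\<in>b. l = 3 * i + 3 then l + 1 else if \<exists>i\<in>b. l = 3 * i + 4 then l - 1 else l)" for l
  define c where "c l = (if l < 3 \<or> (\<exists>i. i < N \<and> i \<notin> b \<and> (l = 3 * i + 3 \<or> l = 3 * i + 4)) then Red else Blue)" for l
  have ne: "3 * i + 3 \<noteq> 3 * j + 4" "3 * i + 2 \<noteq> 3 * j + 3" "3 * i + 2 \<noteq> 3 * j + 4" for i j :: nat
    by presburger+
  have q: "(\<exists>j\<in>b. 3 * i + 3 = 3 * j + 3) = (i \<in> b)" "(\<exists>j\<in>b. 3 * i + 4 = 3 * j + 4) = (i \<in> b)"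
    "(\<exists>j\<in>b. 3 * i + 3 = 3 * j + 4) = False" "(\<exists>j\<in>b. 3 * i + 4 = 3 * j + 3) = False" for i
    using ne(1) by (auto, metis)
  have p3: "p (3 * i + 3) = (if i \<in> b then 3 * i + 4 else 3 * i + 3)"
    and p4: "p (3 * i + 4) = (if i \<in> b then 3 * i + 3 else 3 * i + 4)" for i
    unfolding p_def q by simp_all
  have po: "p l = l" if "\<And>i. i \<in> b \<Longrightarrow> l \<noteq> 3 * i + 3 \<and> l \<noteq> 3 * i + 4" for l
    using that unfolding p_def by auto
  have pp: "p (p l) = l" for l
  proof -
    consider i where "i \<in> b" "l = 3 * i + 3" | i where "i \<in> b" "l = 3 * i + 4"
      | "\<And>i. i \<in> b \<Longrightarrow> l \<noteq> 3 * i + 3 \<and> l \<noteq> 3 * i + 4" by blast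
    then show ?thesis by cases (simp_all add: p3 p4 po)
  qed
  have pn: "p l < n" if "l < n" for l
  proof -
    consider i where "i \<in> b" "l = 3 * i + 3" | i where "i \<in> b" "l = 3 * i + 4"
      | "\<And>i. i \<in> b \<Longrightarrow> l \<noteq> 3 * i + 3 \<and> l \<noteq> 3 * i + 4" by blast
    then show ?thesis
    proof cases
      case 1
      then have "i < N" using assms(3) by auto
      then show ?thesis using 1 assms(2) by (simp add: p3)
    next
      case 2
      then show ?thesis using that by (simp add: p4)
    next
      case 3
      then show ?thesis using that po by simp
    qed
  qed
  have perm: "p permutes {..<n}"
  proof (rule bij_imp_permutes)
    show "bij_betw p {..<n} {..<n}"
      by (rule bij_betw_byWitness[where f' = p]) (use pp pn in auto)
    show "p l = l" if l: "l \<notin> {..<n}" for l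
    proof (rule po)
      fix i assume "i \<in> b"
      then have "i < N" using assms(3) by auto
      then show "l \<noteq> 3 * i + 3 \<and> l \<noteq> 3 * i + 4" using l assms(2) by auto
    qed
  qed
  have e: "(3 * i + 3 = 3 * k + 3) = (k = i)" "(3 * i + 4 = 3 * k + 4) = (k = i)"
    "(3 * i + 3 = 3 * k + 4) = False" "(3 * i + 4 = 3 * k + 3) = False" for i k :: nat
    by presburger+
  have c3: "c (3 * i + 3) = (if i \<in> b then Blue else Red)" "c (3 * i + 4) = (if i \<in> b then Blue else Red)" if "i < N" for i
    using that unfolding c_def e by auto
  have small: "p l = l" "c l = Red" if "l < 3" for l
    using that by (auto simp: c_def intro!: po)
  have mid: "p (3 * i + 2) = 3 * i + 2" "c (3 * i + 2) = Blue" if "i \<ge> 1" for i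
    using that ne by (auto simp: c_def intro!: po)
  have large: "p l = l" "c l = Blue" if "l \<ge> 3 * N + 2" for l
  proof -
    have *: "l \<noteq> 3 * i + 3 \<and> l \<noteq> 3 * i + 4" if "i < N" for i using that \<open>l \<ge> 3 * N + 2\<close> by auto
    show "p l = l" using * assms(3) by (intro po) auto
    show "c l = Blue" using * that assms(1) unfolding c_def by auto
  qed
  let ?g = "\<lambda>l. (l, p l, c l)"
  have gI: "?g l \<in> ?g ` {..<n}" if "l < n" for l by (rule imageI) (use that in simp)
  have block_g: "block b i = {?g (3 * i + 3), ?g (3 * i + 4)}" if "i < N" for i
    by (cases "i \<in> b") (simp_all only: block_def p3 p4 c3[OF that] if_True if_False)
  have "matching n N b = ?g ` {..<n}"
  proof
    show "matching n N b \<subseteq> ?g ` {..<n}"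
    proof
      fix e assume "e \<in> matching n N b"
      then consider "e \<in> core" | i where "i < N" "e \<in> block b i" | i where "i \<in> {1..<N}" "e = (3 * i + 2, 3 * i + 2, Blue)"
        | l where "3 * N + 2 \<le> l" "l < n" "e = (l, l, Blue)"
        unfolding matching_def loose_def by auto
      then show "e \<in> ?g ` {..<n}"
      proof cases
        case 1
        then have "e = ?g 0 \<or> e = ?g 1 \<or> e = ?g 2" by (auto simp: core_def small)
        moreover have "0 < n" "1 < n" "2 < n" using assms(1,2) by auto
        ultimately show ?thesis using gI by (elim disjE) (simp_all only:)
      next
        case 2
        then have "e = ?g (3 * i + 3) \<or> e = ?g (3 * i + 4)"
          unfolding block_g[OF 2(1)] by (simp only: insert_iff empty_iff simp_thms)
        moreover have "3 * i + 3 < n" "3 * i + 4 < n" using assms(2) 2(1) by auto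
        ultimately show ?thesis using gI by (elim disjE) (simp_all only:)
      next
        case 3
        then have i: "1 \<le> i" "3 * i + 2 < n" using assms(2) by auto
        have "e = ?g (3 * i + 2)" unfolding mid[OF i(1)] by (rule 3(2))
        then show ?thesis using gI[OF i(2)] by (simp only:)
      next
        case 4
        have "e = ?g l" unfolding large[OF 4(1)] by (rule 4(3))
        then show ?thesis using gI[OF 4(2)] by (simp only:)
      qed
    qed
    show "?g ` {..<n} \<subseteq> matching n N b"
    proof
      fix e assume "e \<in> ?g ` {..<n}"
      then obtain l where l: "l < n" "e = ?g l" by auto
      show "e \<in> matching n N b"
      proof (cases rule: label_cases[where l = l and N = N])
        case 1
        then have "l = 0 \<or> l = 1 \<or> l = 2" by auto
        then have "e \<in> core" using l(2) small by (auto simp: core_def)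
        then show ?thesis by (simp add: matching_def)
      next
        case (2 i)
        then have "e \<in> block b i" using l(2) by (simp only: block_g insert_iff simp_thms)
        then show ?thesis using 2(1) unfolding matching_def by blast
      next
        case (3 i)
        then have "e \<in> block b i" using l(2) by (simp only: block_g insert_iff simp_thms)
        then show ?thesis using 3(1) unfolding matching_def by blast
      next
        case (4 i)
        then have i: "1 \<le> i" by simp
        have "e = (3 * i + 2, 3 * i + 2, Blue)" using l(2) unfolding 4(2) mid[OF i] .
        then have "e \<in> loose n N" using 4(1) by (auto simp: loose_def)
        then show ?thesis by (simp add: matching_def)
      next
        case 5
        then have "e = (l, l, Blue)" using l(2) by (simp only: large)
        then have "e \<in> loose n N" using l(1) 5 by (auto simp: loose_def)
        then show ?thesis by (simp add: matching_def)
      qed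
    qed
  qed
  then show ?thesis using that perm by blast
qed

subsection \<open>The lower bound\<close>

definition even_cuts :: "nat \<Rightarrow> vertex set set" where
  "even_cuts n = {Z. Z \<subseteq> vertices n \<and> even (card Z)}"

definition odd_matchings :: "nat \<Rightarrow> edge set set" where
  "odd_matchings n = {M. perfect_matching n M \<and> odd (reds M)}"

lemma relabelled_cutset:
  assumes "g \<in> relabellings n" "a \<subseteq> {..<N}" "3 * N + 2 \<le> n"
  shows "act_vertices g (cutset N a) \<in> even_cuts n"
  using act_vertices_subset[OF assms(1) cutset_subset[OF assms(2,3)]] card_act_vertices[OF assms(1)]
    even_card_cutset[OF assms(2)]
  by (simp add: even_cuts_def)

lemma relabelled_matching:
  assumes "g \<in> relabellings n" "b \<subseteq> {..<N}" "3 * N + 2 \<le> n" "N > 0"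
  shows "act_edges g (matching n N b) \<in> odd_matchings n"
proof -
  obtain p c where p: "p permutes {..<n}" and m: "matching n N b = (\<lambda>l. (l, p l, c l)) ` {..<n}"
    by (rule matching_graph[OF assms(4,3,2)])
  have M: "perfect_matching n (act_edges g (matching n N b))"
    unfolding m by (rule perfect_matching_act[OF p assms(1)])
  \<comment> \<open>Red edges are not counted: \<open>a\<close> is chosen so that the cut has three
    or five violations with this matching, and parity gives an odd number of red edges.\<close>
  define a where "a = (if 0 \<in> b then {0} else {} :: nat set)"
  have a: "a \<subseteq> {..<N}" using assms(4) by (simp add: a_def)
  have "odd (viol (cutset N a) (matching n N b))"
    using viol_three[OF assms(4) a, of b n] viol_five[OF assms(4) a, of b n] by (cases "0 \<in> b") (simp_all add: a_def)
  then have "odd (viol (act_vertices g (cutset N a)) (act_edges g (matching n N b)))"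
    using viol_act[OF assms(1)] by simp
  moreover have "act_vertices g (cutset N a) \<subseteq> vertices n" "even (card (act_vertices g (cutset N a)))"
    using relabelled_cutset[OF assms(1) a assms(3)] by (auto simp: even_cuts_def)
  ultimately show ?thesis using viol_parity[OF M] M unfolding odd_matchings_def by auto
qed

text \<open>Up to normalization, \<open>corr n N True\<close> averages over pairs with three violated edges and
  \<open>corr n N False\<close> over pairs with five.\<close>

definition corr :: "nat \<Rightarrow> nat \<Rightarrow> bool \<Rightarrow> (vertex set \<Rightarrow> edge set \<Rightarrow> real) \<Rightarrow> real" where
  "corr n N x F = (\<Sum>g\<in>relabellings n. \<Sum>a | a \<subseteq> {..<N} \<and> (0 \<in> a \<longleftrightarrow> x). \<Sum>b | b \<subseteq> {..<N} \<and> (0 \<in> b \<longleftrightarrow> x).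
      F (act_vertices g (cutset N a)) (act_edges g (matching n N b)))"

lemma corr_cong:
  assumes "\<And>Z M. Z \<in> even_cuts n \<Longrightarrow> M \<in> odd_matchings n \<Longrightarrow> F Z M = F' Z M" "N > 0" "3 * N + 2 \<le> n"
  shows "corr n N x F = corr n N x F'"
  unfolding corr_def using relabelled_cutset relabelled_matching assms by (intro sum.cong refl) auto

lemma corr_sum: "corr n N x (\<lambda>Z M. \<Sum>j\<in>J. F j Z M) = (\<Sum>j\<in>J. corr n N x (F j))"
  unfolding corr_def by (simp only: sum.swap[where B = J])

lemma corr_scale: "corr n N x (\<lambda>Z M. c * F Z M) = c * corr n N x F"
  unfolding corr_def by (simp add: sum_distrib_left)

text \<open>Composition with \<open>swapA i\<close>, \<open>swapB i\<close> and \<open>rot\<close>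
  supplies the symmetries of \<open>hyperplane_bound\<close>. Its conflict condition pairs the cut
  at \<open>g\<close> with the matching rotated twice, where one edge is violated and
  \<open>tight\<close> applies.\<close>

lemma corr_rank_one:
  fixes \<phi> :: "vertex set \<Rightarrow> real" and \<psi> :: "edge set \<Rightarrow> real" and N n :: nat
  assumes N: "N > 0" and n: "3 * N + 2 \<le> n"
    and \<phi>: "\<And>Z. 0 \<le> \<phi> Z \<and> \<phi> Z \<le> 1" and \<psi>: "\<And>M. 0 \<le> \<psi> M \<and> \<psi> M \<le> 1"
    and tight: "\<And>Z M. Z \<in> even_cuts n \<Longrightarrow> M \<in> odd_matchings n \<Longrightarrow> viol Z M = 1 \<Longrightarrow> \<phi> Z * \<psi> M = 0"
  shows "corr n N True (\<lambda>Z M. \<phi> Z * \<psi> M) \<le> 49/100 * corr n N False (\<lambda>Z M. \<phi> Z * \<psi> M)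
    + 3 * real (card (relabellings n)) * 4 ^ N * exp (- (N / 3000000))"
proof -
  let ?G = "relabellings n"
  let ?f = "\<lambda>g a. \<phi> (act_vertices g (cutset N a))" and ?h = "\<lambda>g b. \<psi> (act_edges g (matching n N b))"
  have rot: "rot \<in> ?G" using rot_relabelling N n by simp
  have comp: "relabel_comp g s \<in> ?G" if "g \<in> ?G" "s \<in> ?G" for g s
    using bij_betw_apply[OF bij_betw_relabel_comp[OF that(2)] that(1)] .
  have "(\<Sum>g\<in>?G. (\<Sum>a | a \<subseteq> {..<N} \<and> 0 \<in> a. ?f g a) * (\<Sum>a | a \<subseteq> {..<N} \<and> 0 \<in> a. ?h g a))
    \<le> 49/100 * (\<Sum>g\<in>?G. (\<Sum>a | a \<subseteq> {..<N} \<and> 0 \<notin> a. ?f g a) * (\<Sum>a | a \<subseteq> {..<N} \<and> 0 \<notin> a. ?h g a))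
      + 3 * real (card ?G) * 4 ^ N * exp (- (N / 3000000))"
  proof (rule hyperplane_bound[where s = "\<lambda>i g. relabel_comp g (swapA i)" and t = "\<lambda>i g. relabel_comp g (swapB i)"
        and r = "\<lambda>g. relabel_comp g rot" and f = ?f and h = ?h, OF finite_relabellings N])
    fix i assume i: "i < N"
    show "bij_betw (\<lambda>g. relabel_comp g (swapA i)) ?G ?G" "bij_betw (\<lambda>g. relabel_comp g (swapB i)) ?G ?G"
      using swapA_relabelling[OF i n] swapB_relabelling[OF i n] bij_betw_relabel_comp by auto
    fix g a assume g: "g \<in> ?G" and a: "a \<subseteq> {..<N}"
    have "finite a" using a finite_subset by blast
    show "?f (relabel_comp g (swapA i)) a = ?f g (Transposition.transpose 0 i ` a)"
      by (simp add: act_vertices_comp swapA_cutset)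
    show "?h (relabel_comp g (swapB i)) a = ?h g (Transposition.transpose 0 i ` a)"
      by (simp add: act_edges_comp swapB_matching[OF i n])
    assume "0 \<in> a"
    then show "?h (relabel_comp g (swapA i)) a = ?h g a" "?f (relabel_comp g (swapB i)) a = ?f g a"
      using \<open>finite a\<close> by (simp_all add: act_edges_comp act_vertices_comp swapA_matching[OF i n] swapB_cutset[OF i n])
  next
    show "bij_betw (\<lambda>g. relabel_comp g rot) ?G ?G" by (rule bij_betw_relabel_comp[OF rot])
    fix g assume g: "g \<in> ?G"
    show "relabel_comp (relabel_comp (relabel_comp (relabel_comp (relabel_comp g rot) rot) rot) rot) rot = g"
      by (rule rot_pow5)
    fix a
    show "0 \<le> ?f g a \<and> ?f g a \<le> 1" "0 \<le> ?h g a \<and> ?h g a \<le> 1" using \<phi> \<psi> by blast+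
    assume a: "a \<subseteq> {..<N}"
    show "?f (relabel_comp g rot) a = ?f g a" "?h (relabel_comp g rot) a = ?h g a" if "0 \<notin> a"
      using that by (simp_all add: act_vertices_comp act_edges_comp rot_cutset rot_matching N)
    fix b assume b: "b \<subseteq> {..<N}" "0 \<in> a" "0 \<in> b"
    let ?r = "relabel_comp (relabel_comp g rot) rot"
    show "?f g a * ?h ?r b = 0"
    proof (rule tight)
      show "act_vertices g (cutset N a) \<in> even_cuts n" by (rule relabelled_cutset[OF g a n])
      show "act_edges ?r (matching n N b) \<in> odd_matchings n"
        using comp[OF comp[OF g rot] rot] b(1) n N by (rule relabelled_matching)
      show "viol (act_vertices g (cutset N a)) (act_edges ?r (matching n N b)) = 1"
        unfolding act_edges_comp viol_act[OF g] by (rule viol_conflict[OF N a b(2,3)])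
    qed
  qed
  then show ?thesis unfolding corr_def sum_product by simp
qed

text \<open>Each \<open>g\<close> contributes \<open>(2 ^ (N - 1))\<^sup>2\<close>, a quarter of
  \<open>4 ^ N\<close>, pairs to either sum, with slack 2 or 4; and 2 - 49/100 * 4 is 4/100.\<close>

lemma corr_slack:
  fixes N n :: nat
  assumes N: "N > 0" and n: "3 * N + 2 \<le> n"
  shows "corr n N True (\<lambda>Z M. real (viol Z M) - 1) - 49/100 * corr n N False (\<lambda>Z M. real (viol Z M) - 1)
    = real (card (relabellings n)) * 4 ^ N / 100"
proof -
  let ?G = "relabellings n"
  define A where "A x = {a. a \<subseteq> {..<N} \<and> (0 \<in> a \<longleftrightarrow> x)}" for x
  have "corr n N True (\<lambda>Z M. real (viol Z M) - 1) = (\<Sum>g\<in>?G. \<Sum>a\<in>A True. \<Sum>b\<in>A True. 2)"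
    unfolding corr_def A_def by (intro sum.cong refl) (auto simp: viol_act viol_three[OF N])
  moreover have "corr n N False (\<lambda>Z M. real (viol Z M) - 1) = (\<Sum>g\<in>?G. \<Sum>a\<in>A False. \<Sum>b\<in>A False. 4)"
    unfolding corr_def A_def by (intro sum.cong refl) (auto simp: viol_act viol_five[OF N])
  moreover have F: "A False = Pow {1..<N}" unfolding A_def by (auto simp: subset_iff) (metis One_nat_def Suc_leI gr0I)
  moreover have "A True = insert 0 ` A False"
  proof
    show "insert 0 ` A False \<subseteq> A True" using N unfolding A_def by auto
    show "A True \<subseteq> insert 0 ` A False"
    proof
      fix a assume "a \<in> A True"
      then have "a = insert 0 (a - {0})" "a - {0} \<in> A False" unfolding A_def by auto
      then show "a \<in> insert 0 ` A False" by blast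
    qed
  qed
  moreover have "inj_on (insert 0) (A False)" unfolding A_def by (auto simp: inj_on_def insert_ident)
  ultimately have "card (A False) = 2 ^ (N - 1)" "card (A True) = 2 ^ (N - 1)"
    "corr n N True (\<lambda>Z M. real (viol Z M) - 1) = real (card ?G) * (real (card (A True)))\<^sup>2 * 2"
    "corr n N False (\<lambda>Z M. real (viol Z M) - 1) = real (card ?G) * (real (card (A False)))\<^sup>2 * 4"
    by (simp_all add: card_Pow card_image power2_eq_square)
  moreover have "(2 ^ (N - 1))\<^sup>2 * 4 = (4 :: real) ^ N"
    using N by (cases N) (simp_all add: power_mult[symmetric] mult.commute power2_eq_square flip: power_mult_distrib)
  ultimately show ?thesis by (simp add: algebra_simps)
qed

text \<open>Counting all edges is crude, but any polynomial bound will do.\<close>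

lemma viol_le_card_edges:
  assumes "perfect_matching n M"
  shows "viol Z M \<le> 2 * n\<^sup>2"
proof -
  have "viol Z M \<le> card (edges n)"
    unfolding viol_def using assms finite_edges by (intro card_mono) (auto simp: perfect_matching_def)
  also have "\<dots> = n * (n * card (UNIV :: color set))"
    unfolding edges_def by (simp add: card_cartesian_product)
  also have "(UNIV :: color set) = {Red, Blue}" using color.exhaust by blast
  finally show ?thesis by (simp add: power2_eq_square algebra_simps)
qed

text \<open>An entry of a rank-one term is at most the slack, hence at most
  \<open>2 * n\<^sup>2\<close>, so each term scales to factors in [0, 1] at a polynomial loss. The
  factor 600 is the product of 100 from \<open>corr_slack\<close>, 3 from
  \<open>corr_rank_one\<close> and 2 from this bound.\<close>

lemma nonneg_rank_bound:
  fixes A :: "'j \<Rightarrow> vertex set \<Rightarrow> real" and B :: "'j \<Rightarrow> edge set \<Rightarrow> real" and N n :: nat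
  assumes N: "N > 0" and n: "3 * N + 2 \<le> n" and J: "finite J"
    and A: "\<And>j Z. A j Z \<ge> 0" and B: "\<And>j M. B j M \<ge> 0"
    and S: "\<And>Z M. Z \<in> even_cuts n \<Longrightarrow> M \<in> odd_matchings n \<Longrightarrow> real (viol Z M) - 1 = (\<Sum>j\<in>J. A j Z * B j M)"
  shows "exp (N / 3000000) \<le> 600 * (real n)\<^sup>2 * real (card J)"
proof -
  define err where "err = 3 * real (card (relabellings n)) * 4 ^ N * exp (- (N / 3000000))"
  let ?c = "2 * (real n)\<^sup>2"
  have err0: "err \<ge> 0" unfolding err_def by simp
  have fin: "finite (even_cuts n)" unfolding even_cuts_def using finite_vertices by simp
  have c0: "?c > 0" using n by simp
  have le: "A j Z * B j M \<le> ?c" if "j \<in> J" "Z \<in> even_cuts n" "M \<in> odd_matchings n" for j Z M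
  proof -
    have "A j Z * B j M \<le> (\<Sum>j\<in>J. A j Z * B j M)"
      using J that A B by (intro member_le_sum) auto
    also have "\<dots> \<le> real (viol Z M)" using S[OF that(2,3)] by simp
    also have "\<dots> \<le> real (2 * n\<^sup>2)"
      using viol_le_card_edges that(3) unfolding odd_matchings_def by (intro of_nat_mono) auto
    finally show ?thesis by simp
  qed
  have zero: "A j Z * B j M = 0" if "j \<in> J" "Z \<in> even_cuts n" "M \<in> odd_matchings n" "viol Z M = 1" for j Z M
  proof -
    have "(\<Sum>j\<in>J. A j Z * B j M) = 0" using S[OF that(2,3)] that(4) by simp
    then show ?thesis using sum_nonneg_eq_0_iff[OF J, of "\<lambda>j. A j Z * B j M"] A B that(1) by simp
  qed
  have one: "corr n N True (\<lambda>Z M. A j Z * B j M) - 49/100 * corr n N False (\<lambda>Z M. A j Z * B j M) \<le> ?c * err"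
    if j: "j \<in> J" for j
  proof (cases "\<forall>Z\<in>even_cuts n. A j Z = 0")
    case True
    then have "corr n N x (\<lambda>Z M. A j Z * B j M) = corr n N x (\<lambda>Z M. 0 * 0)" for x
      by (intro corr_cong N n) auto
    then have "corr n N x (\<lambda>Z M. A j Z * B j M) = 0" for x unfolding corr_def by simp
    then show ?thesis using err0 c0 by simp
  next
    case False
    then obtain Z1 where Z1: "Z1 \<in> even_cuts n" "A j Z1 \<noteq> 0" by blast
    define m where "m = Max (A j ` even_cuts n)"
    have ub: "A j Z \<le> m" if "Z \<in> even_cuts n" for Z unfolding m_def using fin that by simp
    have "m \<in> A j ` even_cuts n" unfolding m_def using fin Z1(1) by (intro Max_in) auto
    then obtain Z0 where Z0: "Z0 \<in> even_cuts n" "A j Z0 = m" by blast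
    have m0: "m > 0" using ub[OF Z1(1)] Z1(2) A[of j Z1] by linarith
    \<comment> \<open>Dividing \<open>A j\<close> by its maximum \<open>m\<close> and moving
      \<open>m\<close> to the other factor works because \<open>B j M * m\<close> is itself an
      entry, in row \<open>Z0\<close>, and so at most \<open>?c\<close>. The default 0 secures the
      bounds for all arguments.\<close>
    define \<phi> where "\<phi> Z = (if Z \<in> even_cuts n then A j Z / m else 0)" for Z
    define \<psi> where "\<psi> M = (if M \<in> odd_matchings n then B j M * m / ?c else 0)" for M
    have \<phi>: "0 \<le> \<phi> Z \<and> \<phi> Z \<le> 1" for Z using A[of j Z] ub m0 by (simp add: \<phi>_def)
    have \<psi>: "0 \<le> \<psi> M \<and> \<psi> M \<le> 1" for M
      using B[of j M] le[OF j Z0(1), of M] Z0(2) m0 c0 by (simp add: \<psi>_def mult.commute)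
    have eq: "A j Z * B j M = ?c * (\<phi> Z * \<psi> M)" if "Z \<in> even_cuts n" "M \<in> odd_matchings n" for Z M
      using that m0 c0 by (simp add: \<phi>_def \<psi>_def)
    have "corr n N x (\<lambda>Z M. A j Z * B j M) = ?c * corr n N x (\<lambda>Z M. \<phi> Z * \<psi> M)" for x
    proof -
      have "corr n N x (\<lambda>Z M. A j Z * B j M) = corr n N x (\<lambda>Z M. ?c * (\<phi> Z * \<psi> M))"
        by (rule corr_cong[OF eq N n])
      then show ?thesis by (simp only: corr_scale)
    qed
    moreover have "corr n N True (\<lambda>Z M. \<phi> Z * \<psi> M) \<le> 49/100 * corr n N False (\<lambda>Z M. \<phi> Z * \<psi> M) + err"
      unfolding err_def
    proof (rule corr_rank_one[OF N n \<phi> \<psi>])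
      fix Z M assume "Z \<in> even_cuts n" "M \<in> odd_matchings n" "viol Z M = 1"
      then have "?c * (\<phi> Z * \<psi> M) = 0" using zero[OF j] eq by metis
      then show "\<phi> Z * \<psi> M = 0" using c0 by simp
    qed
    then have "?c * corr n N True (\<lambda>Z M. \<phi> Z * \<psi> M) \<le> ?c * (49/100 * corr n N False (\<lambda>Z M. \<phi> Z * \<psi> M) + err)"
      using c0 by (intro mult_left_mono) auto
    ultimately show ?thesis by (simp add: algebra_simps)
  qed
  have "corr n N x (\<lambda>Z M. real (viol Z M) - 1) = (\<Sum>j\<in>J. corr n N x (\<lambda>Z M. A j Z * B j M))" for x
    unfolding corr_sum[symmetric] by (rule corr_cong[OF S N n])
  then have "real (card (relabellings n)) * 4 ^ N / 100 =
      (\<Sum>j\<in>J. corr n N True (\<lambda>Z M. A j Z * B j M) - 49/100 * corr n N False (\<lambda>Z M. A j Z * B j M))"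
    using corr_slack[OF N n] by (simp add: sum_subtractf sum_distrib_left)
  also have "\<dots> \<le> real (card J) * (?c * err)" using one by (rule sum_bounded_above)
  also have "\<dots> = (real (card (relabellings n)) * 4 ^ N) * (real (card J) * ?c * 3 * exp (- (N / 3000000)))"
    by (simp add: err_def mult_ac)
  finally have "(real (card (relabellings n)) * 4 ^ N) * (1 / 100)
      \<le> (real (card (relabellings n)) * 4 ^ N) * (real (card J) * ?c * 3 * exp (- (N / 3000000)))" by simp
  moreover have "card (relabellings n) > 0"
    using finite_relabellings rot_relabelling[of n] N n by (auto simp: card_gt_0_iff)
  ultimately have "1 / 100 \<le> real (card J) * ?c * 3 * exp (- (N / 3000000))"
    by (subst (asm) mult_le_cancel_left_pos) simp_all
  then have "1 / 100 * exp (N / 3000000) \<le> real (card J) * ?c * 3 * exp (- (N / 3000000)) * exp (N / 3000000)"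
    by (intro mult_right_mono) auto
  also have "\<dots> = real (card J) * ?c * 3" by (simp add: mult.assoc flip: exp_add)
  finally show ?thesis by (simp add: mult_ac)
qed

subsection \<open>Extensions\<close>

lemma lookup_scaleR_poly_mapping:
  "Poly_Mapping.lookup (r *\<^sub>R x) i = r *\<^sub>R Poly_Mapping.lookup (x :: 'i \<Rightarrow>\<^sub>0 real) i"
proof -
  have "finite {i. r *\<^sub>R Poly_Mapping.lookup x i \<noteq> 0}"
    by (rule finite_subset[OF _ finite_keys[of x]]) (auto simp: in_keys_iff)
  then show ?thesis unfolding scaleR_poly_mapping_def by (simp add: Abs_poly_mapping_inverse)
qed

lemma linear_lookup: "linear (\<lambda>x :: 'i \<Rightarrow>\<^sub>0 real. Poly_Mapping.lookup x i)"
  by (rule linearI) (simp_all add: lookup_add lookup_scaleR_poly_mapping)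

definition extension_sizes :: "('i \<Rightarrow>\<^sub>0 real) set \<Rightarrow> nat set" where
  "extension_sizes P = {r. r > 0 \<and>
     (\<exists>m (Q :: (nat \<Rightarrow>\<^sub>0 real) set) (\<pi> :: (nat \<Rightarrow>\<^sub>0 real) \<Rightarrow> ('i \<Rightarrow>\<^sub>0 real)).
        Q \<subseteq> coord_space {..<m} \<and> polytope Q \<and> card {F. is_facet_of F Q} = r \<and> linear \<pi> \<and> \<pi> ` Q = P)}"

text \<open>Repeating one point makes the simplex below have at least two vertices, hence a facet.\<close>

lemma extension_sizes_nonempty:
  fixes W :: "('i \<Rightarrow>\<^sub>0 real) set"
  assumes "finite W" "W \<noteq> {}"
  shows "extension_sizes (convex hull W) \<noteq> {}"
proof -
  obtain k f0 where f0: "W = f0 ` {i. i < (k::nat)}" using finite_imp_nat_seg_image_inj_on[OF assms(1)] by blast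
  then have k: "k > 0" using assms(2) by auto
  define f where "f i = (if i < k then f0 i else f0 0)" for i
  let ?m = "Suc k"
  have fW: "f ` {..<?m} = W" unfolding f0 f_def using k by (auto simp: image_iff)
  define e where "e i = Poly_Mapping.single i (1::real)" for i :: nat
  have le: "Poly_Mapping.lookup (e i) j = (if i = j then 1 else 0)" for i j
    by (simp add: e_def lookup_single when_def)
  let ?Q = "convex hull (e ` {..<?m})"
  define \<pi> where "\<pi> x = (\<Sum>i<?m. Poly_Mapping.lookup x i *\<^sub>R f i)" for x
  have lin: "linear \<pi>"
    unfolding \<pi>_def
    by (rule linearI) (simp_all add: lookup_add lookup_scaleR_poly_mapping scaleR_add_left sum.distrib scaleR_sum_right
        del: sum.lessThan_Suc)
  have \<pi>e: "\<pi> (e i) = f i" if "i < ?m" for i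
  proof -
    have "\<pi> (e i) = (\<Sum>j<?m. if i = j then f j else 0)" unfolding \<pi>_def le by (intro sum.cong) auto
    then show ?thesis using that by (simp del: sum.lessThan_Suc)
  qed
  have "\<pi> ` ?Q = convex hull (\<pi> ` e ` {..<?m})" by (rule convex_hull_linear_image[OF lin])
  also have "\<pi> ` e ` {..<?m} = f ` {..<?m}" using \<pi>e by (simp only: image_image) (intro image_cong, auto)
  finally have image: "\<pi> ` ?Q = convex hull W" by (simp only: fW)
  have "?Q \<subseteq> coord_space {..<?m}"
  proof (rule hull_minimal)
    show "e ` {..<?m} \<subseteq> coord_space {..<?m}" unfolding coord_space_def e_def by auto
    have "coord_space {..<?m} = {x. \<forall>i. i \<notin> {..<?m} \<longrightarrow> Poly_Mapping.lookup x i = (0::real)}"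
      unfolding coord_space_def by (auto simp: in_keys_iff subset_iff)
    then show "convex (coord_space {..<?m} :: (nat \<Rightarrow>\<^sub>0 real) set)"
      by (simp add: convex_def lookup_add lookup_scaleR_poly_mapping)
  qed
  moreover have "polytope ?Q" unfolding polytope_def by blast
  moreover have "card {F. is_facet_of F ?Q} > 0"
  proof -
    have "e 0 \<noteq> e k" using le[of 0 0] le[of k 0] k by auto
    then show ?thesis
      using facet_exists[of "e ` {..<?m}" "e 0" "e k"] finite_facets[of "e ` {..<?m}"] by (simp add: card_gt_0_iff)
  qed
  ultimately show ?thesis unfolding extension_sizes_def using lin image by blast
qed

text \<open>The infimum of a nonempty set of natural numbers is attained, so the value is positive
  and belongs to an actual extension.\<close>

lemma extension_complexity_in:
  assumes "finite W" "W \<noteq> {}"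
  shows "extension_complexity (convex hull W) \<in> extension_sizes (convex hull W)"
  using Inf_nat_def1[OF extension_sizes_nonempty[OF assms]]
  unfolding extension_complexity_def extension_sizes_def .

definition exact_matchings :: "nat \<Rightarrow> nat \<Rightarrow> edge set set" where
  "exact_matchings n K = {M. perfect_matching n M \<and> reds M = K}"

lemma finite_exact_matchings: "finite (exact_matchings n K)"
  by (rule finite_subset[of _ "Pow (edges n)"]) (auto simp: exact_matchings_def perfect_matching_def finite_edges)

lemma exact_matching_polytope_eq:
  "exact_matching_polytope n (int K) = convex hull (char_vec ` exact_matchings n K)"
  unfolding exact_matching_polytope_def exact_matchings_def reds_def by (rule arg_cong[where f = "\<lambda>S. convex hull S"]) auto

lemma exact_matchings_nonempty:
  assumes "K \<le> n"
  shows "exact_matchings n K \<noteq> {}"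
proof -
  let ?M = "(\<lambda>l. (l, id l, if l < K then Red else Blue)) ` {..<n}"
  have "{e \<in> ?M. edge_color e = Red} = (\<lambda>l. (l, l, Red)) ` {..<K}" using assms by (auto split: if_splits)
  then have "reds ?M = K" unfolding reds_def by (simp add: card_image inj_on_def)
  with perfect_matching_permutation[OF permutes_id] have "?M \<in> exact_matchings n K"
    unfolding exact_matchings_def mem_Collect_eq by (rule conjI)
  then show ?thesis by (metis empty_iff)
qed

text \<open>By parity, \<open>L Z\<close> is nonnegative on the polytope for even
  \<open>card Z\<close> and odd \<open>K\<close>. Its pullback along \<open>\<pi>\<close> is a
  nonnegative affine function on \<open>Q\<close>, whose coefficients \<open>c Z F\<close> depend
  only on the cut; evaluation at a preimage \<open>q M\<close> gives factors that depend only on the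
  matching.\<close>

lemma extension_slack_factorization:
  assumes "K \<le> n" "odd K"
  shows "\<exists>(J :: (nat \<Rightarrow>\<^sub>0 real) set set) A B. finite J \<and>
    card J = extension_complexity (exact_matching_polytope n (int K)) \<and>
    (\<forall>F Z. A F Z \<ge> (0::real)) \<and> (\<forall>F M. B F M \<ge> (0::real)) \<and>
    (\<forall>Z\<in>even_cuts n. \<forall>M\<in>exact_matchings n K. real (viol Z M) - 1 = (\<Sum>F\<in>J. A F Z * B F M))"
proof -
  let ?W = "char_vec ` exact_matchings n K"
  let ?P = "exact_matching_polytope n (int K)"
  have finW: "finite ?W" using finite_exact_matchings by simp
  have "extension_complexity ?P \<in> extension_sizes ?P"
    unfolding exact_matching_polytope_eq
    by (rule extension_complexity_in[OF finW]) (use exact_matchings_nonempty[OF assms(1)] in simp)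
  then obtain m Q \<pi> where pos: "extension_complexity ?P > 0" and Q: "polytope Q"
    "card {F. is_facet_of F (Q :: (nat \<Rightarrow>\<^sub>0 real) set)} = extension_complexity ?P" "linear \<pi>" "\<pi> ` Q = ?P"
    unfolding extension_sizes_def by blast
  obtain S where S: "finite S" "Q = convex hull S" using Q(1) unfolding polytope_def by blast
  let ?J = "{F. is_facet_of F Q}"
  have finJ: "finite ?J" "?J \<noteq> {}" using pos unfolding Q(2)[symmetric] card_gt_0_iff by auto
  have "\<exists>a\<in>S. \<exists>b\<in>S. a \<noteq> b"
  proof (rule ccontr)
    assume no: "\<not> ?thesis"
    obtain F where F: "is_facet_of F Q" using finJ(2) by blast
    show False
    proof (cases "S = {}")
      case True
      then have "Q = {}" using S(2) by simp
      then show False using F unfolding is_facet_of_def face_of_def by auto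
    next
      case False
      then obtain a where "S = {a}" using no by blast
      then have "Q = {a}" using S(2) by simp
      then show False using F facets_of_singleton by blast
    qed
  qed
  then obtain a b where ab: "a \<in> S" "b \<in> S" "a \<noteq> b" by blast
  obtain G where G: "\<And>F x. x \<in> Q \<Longrightarrow> G F x \<ge> (0::real)"
    "\<And>f. affine_fun f \<Longrightarrow> (\<And>s. s \<in> S \<Longrightarrow> f s \<ge> 0) \<Longrightarrow>
      \<exists>c. (\<forall>F. c F \<ge> 0) \<and> (\<forall>x\<in>Q. f x = (\<Sum>F\<in>?J. c F * G F x))"
    using slack_factorization[OF S(1) ab finJ(1)[unfolded S(2)]] unfolding S(2) by blast
  define L where "L Z x = (\<Sum>e | e \<in> edges n \<and> violated Z e. Poly_Mapping.lookup x e) + (- 1 :: real)"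
    for Z and x :: "edge \<Rightarrow>\<^sub>0 real"
  have linsum: "linear (\<lambda>x :: edge \<Rightarrow>\<^sub>0 real. \<Sum>e | e \<in> edges n \<and> violated Z e. Poly_Mapping.lookup x e)" for Z
    by (rule linear_compose_sum) (simp add: linear_lookup)
  have Laff: "affine_fun (L Z)" for Z
    unfolding affine_fun_def L_def[abs_def] using linsum by blast
  have Lchar: "L Z (char_vec M) = real (viol Z M) - 1" if "perfect_matching n M" for Z M
  proof -
    have finM: "finite M" using that by (rule perfect_matching_finite)
    have "(\<Sum>e | e \<in> edges n \<and> violated Z e. indicator M e :: real) = card ({e. e \<in> edges n \<and> violated Z e} \<inter> M)"
      using sum.inter_restrict[of "{e. e \<in> edges n \<and> violated Z e}" "\<lambda>_. 1 :: real" M] finite_edges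
      by (simp add: indicator_def of_bool_def)
    also have "{e. e \<in> edges n \<and> violated Z e} \<inter> M = {e \<in> M. violated Z e}"
      using that unfolding perfect_matching_def by auto
    finally show ?thesis unfolding L_def lookup_char_vec[OF finM] viol_def by simp
  qed
  have "\<exists>c. (\<forall>F. c F \<ge> 0) \<and> (\<forall>x\<in>Q. L Z (\<pi> x) = (\<Sum>F\<in>?J. c F * G F x))" if Z: "Z \<in> even_cuts n" for Z
  proof (rule G(2))
    show "affine_fun (\<lambda>x. L Z (\<pi> x))"
      using linear_compose[OF Q(3) linsum[of Z]] unfolding affine_fun_def L_def o_def by blast
    fix s assume "s \<in> S"
    then have "\<pi> s \<in> convex hull ?W"
      using Q(4) S(2) hull_inc[of s S convex] unfolding exact_matching_polytope_eq by blast
    then show "L Z (\<pi> s) \<ge> 0"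
    proof (rule affine_fun_nonneg_on_hull[OF finW Laff, rotated])
      fix w assume "w \<in> ?W"
      then obtain M where M: "w = char_vec M" "perfect_matching n M" "reds M = K"
        unfolding exact_matchings_def by blast
      have "odd (viol Z M)"
        using viol_parity[OF M(2), of Z] Z M(3) assms(2) unfolding even_cuts_def by simp
      then have "viol Z M \<ge> 1" by (metis One_nat_def Suc_leI even_zero gr0I)
      then show "L Z w \<ge> 0" unfolding M(1) Lchar[OF M(2)] by simp
    qed
  qed
  then have "\<forall>Z\<in>even_cuts n. \<exists>c. (\<forall>F. c F \<ge> 0) \<and> (\<forall>x\<in>Q. L Z (\<pi> x) = (\<Sum>F\<in>?J. c F * G F x))" by blast
  from bchoice[OF this] obtain c where c: "\<And>Z F. Z \<in> even_cuts n \<Longrightarrow> c Z F \<ge> 0"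
    "\<And>Z x. Z \<in> even_cuts n \<Longrightarrow> x \<in> Q \<Longrightarrow> L Z (\<pi> x) = (\<Sum>F\<in>?J. c Z F * G F x)"
    by blast
  have "\<exists>q\<in>Q. \<pi> q = char_vec M" if "M \<in> exact_matchings n K" for M
  proof -
    have "char_vec M \<in> \<pi> ` Q" unfolding Q(4) exact_matching_polytope_eq using that by (intro hull_inc imageI)
    then show ?thesis by (metis imageE)
  qed
  then obtain q where q: "\<And>M. M \<in> exact_matchings n K \<Longrightarrow> q M \<in> Q \<and> \<pi> (q M) = char_vec M" by metis
  let ?A = "\<lambda>F Z. if Z \<in> even_cuts n then c Z F else 0"
  let ?B = "\<lambda>F M. if M \<in> exact_matchings n K then G F (q M) else 0"
  have "real (viol Z M) - 1 = (\<Sum>F\<in>?J. ?A F Z * ?B F M)" if Z: "Z \<in> even_cuts n" and M: "M \<in> exact_matchings n K" for Z M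
  proof -
    have "real (viol Z M) - 1 = L Z (\<pi> (q M))" using q[OF M] Lchar M unfolding exact_matchings_def by simp
    also have "\<dots> = (\<Sum>F\<in>?J. c Z F * G F (q M))" using c(2)[OF Z] q[OF M] by blast
    finally show ?thesis using Z M by simp
  qed
  moreover have "?A F Z \<ge> 0" "?B F M \<ge> 0" for F Z M using c(1) G(1) q by auto
  ultimately show ?thesis using finJ(1) Q(2) by (intro exI[of _ ?J] exI[of _ ?A] exI[of _ ?B]) blast
qed

section \<open>Combining all odd numbers of red edges\<close>

lemma reds_le:
  assumes "perfect_matching n M"
  shows "reds M \<le> n"
proof -
  have inj: "inj_on fst {e \<in> M. edge_color e = Red}"
  proof (rule inj_onI)
    fix e e' assume *: "e \<in> {e \<in> M. edge_color e = Red}" "e' \<in> {e \<in> M. edge_color e = Red}" "fst e = fst e'"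
    have "fst e < n" using * assms unfolding perfect_matching_def edges_def by auto
    then have "\<exists>!d. d \<in> M \<and> Inl (fst e) \<in> ends d"
      using assms unfolding perfect_matching_def vertices_def by auto
    moreover have "Inl (fst d) \<in> ends d" for d by (cases d) simp
    ultimately show "e = e'" using * by (metis mem_Collect_eq)
  qed
  have "fst ` {e \<in> M. edge_color e = Red} \<subseteq> {..<n}"
    using assms unfolding perfect_matching_def edges_def by auto
  then have "card (fst ` {e \<in> M. edge_color e = Red}) \<le> card {..<n}" by (intro card_mono) auto
  then show ?thesis using card_image[OF inj] unfolding reds_def by simp
qed

text \<open>The factorizations for all odd \<open>K\<close> are put side by side. A term belonging
  to \<open>K\<close> is set to zero on matchings with another number of red edges, so each column
  sees only its own factorization, and there are at most \<open>(n + 1) * R\<close> terms.\<close>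

lemma max_extension_complexity_bound:
  fixes N n :: nat
  assumes N: "N > 0" and n: "3 * N + 2 \<le> n"
    and R: "\<And>K. K \<le> n \<Longrightarrow> extension_complexity (exact_matching_polytope n (int K)) \<le> R"
  shows "exp (N / 3000000) \<le> 600 * (real n)\<^sup>2 * ((real n + 1) * real R)"
proof -
  let ?Ks = "{K. K \<le> n \<and> odd K}"
  define P where "P K J A B \<longleftrightarrow> finite J \<and>
    card J = extension_complexity (exact_matching_polytope n (int K)) \<and>
    (\<forall>F Z. A F Z \<ge> (0::real)) \<and> (\<forall>F M. B F M \<ge> (0::real)) \<and>
    (\<forall>Z\<in>even_cuts n. \<forall>M\<in>exact_matchings n K. real (viol Z M) - 1 = (\<Sum>F\<in>J. A F Z * B F M))"
    for K and J :: "(nat \<Rightarrow>\<^sub>0 real) set set" and A B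
  have "\<forall>K\<in>?Ks. \<exists>J A B. P K J A B"
    unfolding P_def using extension_slack_factorization[of _ n] by blast
  then obtain J A B where P: "\<And>K. K \<in> ?Ks \<Longrightarrow> P K (J K) (A K) (B K)" by metis
  have J: "finite (J K)" "card (J K) \<le> R" and A: "\<And>F Z. A K F Z \<ge> 0" and B: "\<And>F M. B K F M \<ge> 0"
    and S: "\<And>Z M. Z \<in> even_cuts n \<Longrightarrow> M \<in> exact_matchings n K \<Longrightarrow>
      real (viol Z M) - 1 = (\<Sum>F\<in>J K. A K F Z * B K F M)"
    if "K \<in> ?Ks" for K
    using P[OF that] R[of K] that unfolding P_def by simp_all
  let ?J = "Sigma ?Ks J"
  let ?A = "\<lambda>j Z. if fst j \<in> ?Ks then A (fst j) (snd j) Z else 0"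
  let ?B = "\<lambda>j M. if fst j \<in> ?Ks \<and> reds M = fst j then B (fst j) (snd j) M else 0"
  have finK: "finite ?Ks" by simp
  have "exp (N / 3000000) \<le> 600 * (real n)\<^sup>2 * real (card ?J)"
  proof (rule nonneg_rank_bound[OF N n, of ?J ?A ?B])
    show "finite ?J" using finK J(1) by blast
    show "?A j Z \<ge> 0" for j Z using A by simp
    show "?B j M \<ge> 0" for j M using B by simp
    fix Z M assume Z: "Z \<in> even_cuts n" and M: "M \<in> odd_matchings n"
    let ?K = "reds M"
    have K: "?K \<in> ?Ks" using M reds_le unfolding odd_matchings_def by auto
    define f where "f j = ?A j Z * ?B j M" for j
    have "(\<Sum>j\<in>?J. f j) = (\<Sum>k\<in>?Ks. \<Sum>F\<in>J k. f (k, F))"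
      using sum.Sigma[of ?Ks J "\<lambda>k F. f (k, F)"] finK J(1) by (simp add: case_prod_unfold)
    also have "\<dots> = (\<Sum>k\<in>?Ks. if k = ?K then \<Sum>F\<in>J k. A k F Z * B k F M else 0)"
      by (intro sum.cong refl) (auto simp: f_def)
    also have "\<dots> = (\<Sum>F\<in>J ?K. A ?K F Z * B ?K F M)" using K finK by (simp add: sum.delta)
    also have "\<dots> = real (viol Z M) - 1"
      using S[OF K Z, of M] M unfolding odd_matchings_def exact_matchings_def by simp
    finally show "real (viol Z M) - 1 = (\<Sum>j\<in>?J. ?A j Z * ?B j M)" by (simp add: f_def)
  qed
  also have "\<dots> \<le> 600 * (real n)\<^sup>2 * ((real n + 1) * real R)"
  proof (intro mult_left_mono)
    have "card ?J = (\<Sum>K\<in>?Ks. card (J K))" using finK J(1) by simp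
    also have "\<dots> \<le> card ?Ks * R" using sum_bounded_above[of ?Ks "\<lambda>K. card (J K)" R] J(2) by simp
    also have "card ?Ks \<le> card {..n}" by (intro card_mono) auto
    finally have "card ?J \<le> (n + 1) * R" by simp
    then have "real (card ?J) \<le> real ((n + 1) * R)" by (rule of_nat_mono)
    then show "real (card ?J) \<le> (real n + 1) * real R" by (simp add: algebra_simps)
  qed auto
  finally show ?thesis .
qed

text \<open>The available rate is about 1 / 9000000, a third of 1 / 3000000. It exceeds 2 /
  20000000, so a rate 1 / 20000000 can be kept and as much again spent on the polynomial. In the
  threshold, 3600 = 600 * 2 * 3, with 2 from \<open>n + 1 \<le> 2 * n\<close> and 3 from
  \<open>exp 1 \<le> 3\<close>, which absorbs the shift by 4; 80000000 is four times 20000000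
  because \<open>y \<le> exp y\<close> is raised to the fourth power.\<close>

lemma eventually_cubic_le_exp:
  "eventually (\<lambda>n. exp (1/20000000 * real n) * (600 * (real n)\<^sup>2 * (real n + 1)) \<le> exp ((real n - 4) / 9000000)) at_top"
  using eventually_ge_at_top[of "nat \<lceil>3600 * 80000000 ^ 4 :: real\<rceil>"]
proof eventually_elim
  case (elim n)
  then have n: "real n \<ge> 3600 * 80000000 ^ 4" by linarith
  define y where "y = real n / 80000000"
  have y: "y \<ge> 0" unfolding y_def by simp
  have "600 * (real n)\<^sup>2 * (real n + 1) \<le> 600 * (real n)\<^sup>2 * (2 * real n)"
    using n by (intro mult_left_mono) auto
  also have "\<dots> = 1200 * real n ^ 3" by (simp add: power2_eq_square power3_eq_cube)
  also have "1200 * real n ^ 3 * 3 \<le> real n / 80000000 ^ 4 * real n ^ 3"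
    using mult_right_mono[OF n, of "real n ^ 3 / 80000000 ^ 4"] by simp
  also have "\<dots> = y ^ 4" unfolding y_def by (simp add: power_divide power3_eq_cube power4_eq_xxxx)
  also have "\<dots> \<le> exp y ^ 4" using y exp_ge_add_one_self[of y] by (intro power_mono) linarith+
  also have "\<dots> = exp (1/20000000 * real n)" unfolding y_def by (simp flip: exp_of_nat_mult)
  finally have "600 * (real n)\<^sup>2 * (real n + 1) * 3 \<le> exp (1/20000000 * real n)" by simp
  then have "exp (1/20000000 * real n) * (600 * (real n)\<^sup>2 * (real n + 1) * 3)
      \<le> exp (1/20000000 * real n) * exp (1/20000000 * real n)"
    by (intro mult_left_mono) auto
  also have "\<dots> = exp (2/20000000 * real n)" by (simp flip: exp_add)
  also have "\<dots> \<le> exp ((real n - 4) / 9000000 + 1)"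
  proof -
    have "0 \<le> real n" by simp
    then have "2/20000000 * real n \<le> (real n - 4) / 9000000 + 1" by (simp add: field_simps)
    then show ?thesis by (rule exp_le_cancel_iff[THEN iffD2])
  qed
  also have "\<dots> \<le> exp ((real n - 4) / 9000000) * 3"
    unfolding exp_add using exp_le by (intro mult_left_mono) auto
  finally show ?case by (simp add: mult.commute mult.left_commute)
qed

theorem theorem1p1:
  shows "\<exists>k :: nat \<Rightarrow> int. \<exists>g \<in> \<Omega>(\<lambda>n. real n). \<forall>n > 0.
           real (extension_complexity (exact_matching_polytope n (k n))) = 2 powr (g n)"
proof -
  define x where "x n K = extension_complexity (exact_matching_polytope n (int K))" for n K
  have "\<exists>K. K \<le> n \<and> (\<forall>K'\<le>n. x n K' \<le> x n K)" for n
  proof -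
    have "Max (x n ` {..n}) \<in> x n ` {..n}" by (rule Max_in) auto
    then obtain K where K: "K \<le> n" "x n K = Max (x n ` {..n})"
      by (metis atMost_iff imageE)
    then have "\<forall>K'\<le>n. x n K' \<le> x n K" by auto
    then show ?thesis using K(1) by blast
  qed
  then obtain k where k: "\<And>n. k n \<le> n" "\<And>n K. K \<le> n \<Longrightarrow> x n K \<le> x n (k n)" by metis
  define g where "g n = log 2 (real (x n (k n)))" for n
  have pos: "x n (k n) > 0" for n
  proof -
    have "x n (k n) \<in> extension_sizes (exact_matching_polytope n (int (k n)))"
      unfolding x_def exact_matching_polytope_eq
      using exact_matchings_nonempty[OF k(1)] finite_exact_matchings by (intro extension_complexity_in) auto
    then show ?thesis unfolding extension_sizes_def by simp
  qed
  have eq: "real (x n (k n)) = 2 powr (g n)" for n using pos[of n] by (simp add: g_def)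
  have "eventually (\<lambda>n. exp (1/20000000 * real n) * (600 * (real n)\<^sup>2 * (real n + 1)) \<le> exp ((real n - 4) / 9000000)) at_top"
    by (rule eventually_cubic_le_exp)
  then have "eventually (\<lambda>n. 1/20000000 * real n \<le> g n) at_top"
    using eventually_ge_at_top[of 5]
  proof eventually_elim
    case (elim n)
    \<comment> \<open>The largest number of gadgets that fits. Rounding leaves at most two labels
      over, hence the bound with \<open>n - 4\<close>.\<close>
    define N where "N = (n - 2) div 3"
    have N: "N > 0" "3 * N + 2 \<le> n" "(real n - 4) / 9000000 \<le> real N / 3000000"
    proof -
      show "N > 0" "3 * N + 2 \<le> n" using elim(2) unfolding N_def by auto
      have "n \<le> 3 * N + 4" unfolding N_def by presburger
      then show "(real n - 4) / 9000000 \<le> real N / 3000000" by simp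
    qed
    have "exp ((real n - 4) / 9000000) \<le> exp (real N / 3000000)" using N(3) by simp
    also have "\<dots> \<le> 600 * (real n)\<^sup>2 * ((real n + 1) * real (x n (k n)))"
      using max_extension_complexity_bound[OF N(1,2), of "x n (k n)"] k(2) unfolding x_def by blast
    also have "\<dots> = real (x n (k n)) * (600 * (real n)\<^sup>2 * (real n + 1))" by (simp only: mult_ac)
    finally have "exp (1/20000000 * real n) * (600 * (real n)\<^sup>2 * (real n + 1))
        \<le> real (x n (k n)) * (600 * (real n)\<^sup>2 * (real n + 1))"
      using elim(1) by linarith
    then have "exp (1/20000000 * real n) \<le> real (x n (k n))"
      by (rule mult_right_le_imp_le) (use elim(2) in simp)
    moreover have "2 powr (1/20000000 * real n) \<le> exp (1/20000000 * real n)"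
      using ln_2_less_1 by (simp add: powr_def mult_left_le)
    ultimately have "2 powr (1/20000000 * real n) \<le> 2 powr (g n)" using eq[of n] by linarith
    then show ?case by simp
  qed
  then have "eventually (\<lambda>n. norm (g n) \<ge> 1/20000000 * norm (real n)) at_top"
    by (rule eventually_mono) (simp add: abs_le_iff order_trans[OF _ abs_ge_self])
  then have g: "g \<in> \<Omega>(\<lambda>n. real n)" by (intro landau_omega.bigI[of "1/20000000"]) simp_all
  show ?thesis
  proof (rule exI[of _ "\<lambda>n. int (k n)"], rule bexI[of _ g])
    show "\<forall>n>0. real (extension_complexity (exact_matching_polytope n (int (k n)))) = 2 powr (g n)"
      using eq unfolding x_def by blast
  qed (rule g)
qed

end
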